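(* Let $q$ be an integer such that $|q|$ is a prime or $q=-1$, and let $D_{2,q}(N)$ denote the number of $D(q)$-pairs with both elements in $\{1,2,\dots,N\}$. As $N\to\infty$: (a) if $q\equiv 3\pmod 4$, then $D_{2,q}(N)\sim \frac{L(1,\chi_{4|q|,4|q|-1})}{\zeta(2)}\,N$; (b) if $q\equiv 5\pmod 8$, then $D_{2,q}(N)\sim \frac{2L(1,\chi_{|q|,|q|-1})}{\zeta(2)}\,N$; (c) if $q\equiv 1\pmod 8$, then $D_{2,q}(N)\sim \frac{L(1,\chi_{|q|,|q|-1})}{\zeta(2)}\,N$.
   Context: For a non-zero integer $q$, a $D(q)$-pair is a set $\{a,b\}$ of two distinct positive integers such that $ab+q$ is a perfect square. For $q\equiv 1\pmod 4$, $\chi_{|q|,|q|-1}$ is the Dirichlet character $a\mapsto \left(\frac{q}{a}\right)$ (Kronecker symbol). For $q\equiv 3\pmod 4$, $\chi_{4|q|,4|q|-1}$ is the Dirichlet character $a\mapsto\left(\frac{4q}{a}\right)$ (Kronecker symbol); for $q=-1$ this is the character $\chi_{4,3}$ modulo $4$ with $\chi_{4,3}(a)=0$ for even $a$, $1$ for $a\equiv1\pmod 4$, $-1$ for $a\equiv 3\pmod 4$. For a Dirichlet character $\chi$, $L(s,\chi)=\sum_{n\ge1}\chi(n)n^{-s}$ for $\Re s>1$ and $L(1,\chi)$ is the value at $s=1$ of its analytic continuation. $\zeta$ is the Riemann zeta function. *)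

theory Defs
  imports
    "HOL-Complex_Analysis.Complex_Analysis"
    "HOL-Number_Theory.Number_Theory"
    "HOL-Library.Landau_Symbols"
    "HOL-Computational_Algebra.Nth_Powers"
begin

(* A perfect square is the square of any integer, 0 included. *)
definition D_pair :: "int \<Rightarrow> nat set \<Rightarrow> bool" where
  "D_pair q P \<longleftrightarrow>
     (\<exists>a b. P = {a, b} \<and> a \<noteq> b \<and> 0 < a \<and> 0 < b \<and> is_square (int a * int b + q))"

definition D2 :: "int \<Rightarrow> nat \<Rightarrow> nat" where
  "D2 q N = card {P. D_pair q P \<and> P \<subseteq> {1..N}}"

definition kronecker_prime :: "int \<Rightarrow> int \<Rightarrow> int" where
  "kronecker_prime a p =
     (if p = 2 then (if even a then 0 else if a mod 8 = 1 \<or> a mod 8 = 7 then 1 else -1)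
      else Legendre a p)"

(* The conditional in front of the product is the value of the symbol at the sign of n. *)
definition kronecker :: "int \<Rightarrow> int \<Rightarrow> int" where
  "kronecker a n =
     (if n = 0 then (if \<bar>a\<bar> = 1 then 1 else 0)
      else (if n < 0 \<and> a < 0 then -1 else 1) *
           (\<Prod>p\<in>#prime_factorization n. kronecker_prime a p))"

definition kronecker_char :: "int \<Rightarrow> nat \<Rightarrow> complex" where
  "kronecker_char d n = of_int (kronecker d (int n))"

(* F is an analytic continuation to S of the Dirichlet series with coefficients
   c 1, c 2, ...; the value c 0 plays no role. *)
definition dirichlet_continuation ::
    "(nat \<Rightarrow> complex) \<Rightarrow> (complex \<Rightarrow> complex) \<Rightarrow> complex set \<Rightarrow> bool" where
  "dirichlet_continuation c F S \<longleftrightarrow>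
     open S \<and> connected S \<and> {z. Re z > 1} \<subseteq> S \<and> F holomorphic_on S \<and>
     (\<forall>z. Re z > 1 \<longrightarrow> (\<lambda>n. c (Suc n) * of_nat (Suc n) powr (- z)) sums F z)"

(* For c a Dirichlet character the value does not depend on the choice of S and F, since
   the series continues to a single-valued function on the plane, except possibly for a
   pole at 1. At a pole no continuation exists and the value is unspecified. *)
definition L_function :: "complex \<Rightarrow> (nat \<Rightarrow> complex) \<Rightarrow> complex" where
  "L_function s c = (THE v. \<exists>F S. dirichlet_continuation c F S \<and> s \<in> S \<and> F s = v)"

definition riemann_zeta :: "complex \<Rightarrow> complex" where
  "riemann_zeta s = L_function s (\<lambda>_. 1)"

end

(* The larger element b of a D(q)-pair determines the pair up to a square root r of q modulo b:
   for b > 2|q| + 2 and ab + q = r^2 with r >= 0, one has 1 <= a < b if and only if 0 <= r < b.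
   So D2 q N is, up to a bounded error, the sum over b <= N of the number of square roots of q
   modulo b. As a function of b this number is multiplicative and equals the Dirichlet convolution
   of 1 * chi with a function g for which the sum of |g(n)|/n converges, so its mean value is the
   product of L(1, chi), which is the mean value of 1 * chi, and of the sum of g(n)/n, which is
   1/zeta(2) times a rational factor coming from the prime 2. The convergence of the partial sums
   is an asymptotic equivalence because L(1, chi) is not 0, shown by Monsky's argument.

   The value L(1, chi) in the statement is the common value at 1 of all analytic continuations to
   connected open sets, so an entire continuation is needed; it is obtained by summation by parts
   applied repeatedly to the Dirichlet series. *)

theory Submission
  imports Defs
begin

section \<open>Continuation of Dirichlet series with periodic coefficients\<close>

text \<open>The shape of g comes from comparing Euler factors. In x = p^-s, the counts of square
  roots of q modulo powers of an odd prime p form the series (1 + x) / (1 - c x), where c is the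
  character value at p, in the ramified case too. This is (1 - x^2) / ((1 - x) (1 - c x)), so the
  odd primes force the factor 1/zeta(2 s), represented by \<open>moebius_sqrt\<close>. Only at 2
  does the pattern break, and a polynomial supported on 1, 2, 4, depending on q modulo 8, repairs
  it. The constant 6 / pi^2 is found by comparing mean values: convolving 1 with
  \<open>moebius_sqrt\<close> and then with the indicator of the squares gives 1 back. Absolute
  convergence lets g transfer mean values, but the mean value of 1 * chi rests on cancellation in
  chi, that is, on bounded partial sums. The Kronecker symbol is defined prime by prime in its lower
  argument, where no periodicity is visible; quadratic reciprocity supplies the period, and with it
  both the continuation of the L-function and the cancellation.\<close>

primrec powr_diff :: "nat \<Rightarrow> complex \<Rightarrow> complex \<Rightarrow> complex" where
  "powr_diff 0 s z = z powr (-s)"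
| "powr_diff (Suc j) s z = powr_diff j s (z + 1) - powr_diff j s z"

lemma has_field_derivative_powr_diff:
  "Re z > 0 \<Longrightarrow> (powr_diff j s has_field_derivative - s * powr_diff j (s + 1) z) (at z)"
proof (induction j arbitrary: z)
  case 0
  have "z \<notin> \<real>\<^sub>\<le>\<^sub>0" using 0 by (auto simp: complex_nonpos_Reals_iff)
  then have "((\<lambda>z. z powr (-s)) has_field_derivative (-s * z powr (-s - 1))) (at z)"
    by (rule has_field_derivative_powr)
  moreover have "-s - 1 = - (s + 1)" by simp
  moreover have "powr_diff 0 s = (\<lambda>z. z powr (-s))" by (simp add: fun_eq_iff)
  ultimately show ?case by (simp only: powr_diff.simps)
next
  case (Suc j)
  have 1: "(powr_diff j s has_field_derivative - s * powr_diff j (s + 1) z) (at z)"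
    using Suc by auto
  have "(powr_diff j s has_field_derivative - s * powr_diff j (s + 1) (z + 1)) (at (z + 1))"
    using Suc by auto
  then have 2: "((\<lambda>z. powr_diff j s (z + 1)) has_field_derivative - s * powr_diff j (s + 1) (z + 1)) (at z)"
    by (simp only: DERIV_shift)
  from DERIV_diff[OF 2 1] show ?case
    by (simp add: algebra_simps)
qed

lemma holomorphic_on_powr_diff:
  "Re z > 0 \<Longrightarrow> (\<lambda>s. powr_diff j s z) holomorphic_on A"
proof (induction j arbitrary: z)
  case 0
  then have "z \<noteq> 0" by auto
  then show ?case by (auto intro!: holomorphic_intros)
next
  case (Suc j)
  then show ?case by (auto intro!: holomorphic_intros)
qed

text \<open>Each forward difference of \<open>z powr (-s)\<close> gains a power of \<open>x\<close>.
  The derivative of the j-th difference is \<open>- s * powr_diff j (s + 1) z\<close>, so the mean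
  value inequality on the segment from \<open>x\<close> to \<open>x + 1\<close> reduces the next
  difference to the induction hypothesis at \<open>s + 1\<close>. This produces the factor
  \<open>norm s\<close> and shifts the remaining product. The sign condition makes the power
  decreasing, hence largest at the left end.\<close>

lemma norm_powr_diff_le:
  assumes "x > 0" "Re s + real j \<ge> 0"
  shows "norm (powr_diff j s (of_real x)) \<le> (\<Prod>i<j. norm (s + of_nat i)) * x powr (-(Re s + real j))"
  using assms
proof (induction j arbitrary: s x)
  case 0
  then show ?case by (simp add: norm_powr_real_powr)
next
  case (Suc j)
  let ?S = "closed_segment (of_real x) (of_real (x + 1)) :: complex set"
  define P where "P = (\<Prod>i<j. norm (s + 1 + of_nat i))"
  have P: "P \<ge> 0" by (auto simp: P_def intro!: prod_nonneg)
  have S: "\<exists>y. z = of_real y \<and> x \<le> y" if "z \<in> ?S" for z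
    using that unfolding closed_segment_of_real closed_segment_eq_real_ivl by auto
  have "norm (powr_diff j s (of_real (x + 1)) - powr_diff j s (of_real x))
        \<le> (norm s * (P * x powr (-(Re s + real (Suc j))))) * norm (of_real (x+1) - of_real x :: complex)"
  proof (rule field_differentiable_bound[where S = ?S])
    show "convex ?S" by simp
    fix z assume "z \<in> ?S"
    then obtain y where y: "z = of_real y" "x \<le> y" using S by blast
    have y0: "y > 0" using y Suc.prems by simp
    show "(powr_diff j s has_field_derivative - s * powr_diff j (s + 1) z) (at z within ?S)"
      by (rule has_field_derivative_at_within, rule has_field_derivative_powr_diff) (use y y0 in simp)
    have "norm (powr_diff j (s + 1) z) \<le> P * y powr (-(Re (s + 1) + real j))"
      unfolding y P_def by (rule Suc.IH) (use y0 Suc.prems in auto)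
    also have "-(Re (s + 1) + real j) = -(Re s + real (Suc j))" by simp
    also have "P * y powr \<dots> \<le> P * x powr \<dots>"
      by (intro mult_left_mono powr_mono2' P) (use Suc.prems y in auto)
    finally show "norm (- s * powr_diff j (s + 1) z) \<le> norm s * (P * x powr (-(Re s + real (Suc j))))"
      by (simp add: norm_mult mult_left_mono)
  qed auto
  moreover have "(\<Prod>i<Suc j. norm (s + of_nat i)) = norm s * P"
    unfolding P_def prod.lessThan_Suc_shift by (simp add: add_ac)
  ultimately show ?case by (simp add: mult_ac)
qed

text \<open>Partial sums of a periodic sequence of mean zero are again periodic. Subtracting their
  average over a period restores mean zero, so that the construction can be iterated.\<close>

lemma sum_zero_imp_periodic_antidifference:
  fixes a :: "nat \<Rightarrow> complex"
  assumes "m > 0" and per: "\<And>n. a (n + m) = a n" and zero: "(\<Sum>n<m. a n) = 0"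
  obtains A where "\<And>n. A (n + m) = A n" "(\<Sum>n<m. A n) = 0" "\<And>n. A (Suc n) - A n = a n"
proof
  define B where "B n = (\<Sum>i<n. a i)" for n
  define A where "A n = B n - (\<Sum>n<m. B n) / of_nat m" for n
  have B: "B (n + m) = B n" for n
  proof (induction n)
    case (Suc n)
    then show ?case using per[of n] by (simp add: B_def)
  qed (use zero in \<open>simp add: B_def\<close>)
  show "A (n + m) = A n" for n by (simp add: A_def B)
  show "(\<Sum>n<m. A n) = 0" using \<open>m > 0\<close> by (simp add: A_def sum_subtractf)
  show "A (Suc n) - A n = a n" for n by (simp add: A_def B_def)
qed

lemma periodic_mod:
  fixes a :: "nat \<Rightarrow> 'a"
  assumes "\<And>n. a (n + m) = a n"
  shows "a (n mod m) = a n"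
proof -
  have "a (n + k * m) = a n" for n k
  proof (induction k)
    case (Suc k)
    then show ?case using assms[of "n + k * m"] by (simp add: algebra_simps)
  qed simp
  from this[of "n mod m" "n div m"] show ?thesis by simp
qed

lemma periodic_bounded:
  fixes a :: "nat \<Rightarrow> 'a :: real_normed_vector"
  assumes "m > 0" "\<And>n. a (n + m) = a n"
  obtains K where "K > 0" "\<And>n. norm (a n) \<le> K"
proof
  show "(\<Sum>i<m. norm (a i)) + 1 > 0"
    by (meson add_nonneg_pos norm_ge_zero sum_nonneg zero_less_one)
  fix n
  have "norm (a n) = norm (a (n mod m))" using periodic_mod[of a m, OF assms(2)] by simp
  also have "\<dots> \<le> (\<Sum>i<m. norm (a i))"
    by (rule member_le_sum) (use assms in auto)
  finally show "norm (a n) \<le> (\<Sum>i<m. norm (a i)) + 1" by simp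
qed

text \<open>The j-th difference at n decays like n to the power -(Re s + j), so bounded coefficients
  give locally uniform absolute convergence to the right of 1 - j.\<close>

lemma powr_diff_series_holomorphic:
  fixes a :: "nat \<Rightarrow> complex"
  assumes K: "\<And>n. norm (a n) \<le> K"
  obtains F where "F holomorphic_on {s. Re s > 1 - real j}"
    "\<And>s. Re s > 1 - real j \<Longrightarrow> (\<lambda>n. a n * powr_diff j s (of_nat (Suc n))) sums F s"
proof -
  define U where "U = {s::complex. Re s > 1 - real j}"
  have opU: "open U" unfolding U_def by (simp add: open_halfspace_Re_gt)
  define f where "f n s = a n * powr_diff j s (of_nat (Suc n))" for n s
  have K0: "K \<ge> 0" using K[of 0] norm_ge_zero order_trans by blast
  have loc: "\<exists>d>0. cball s d \<subseteq> U \<and>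
      uniform_limit (cball s d) (\<lambda>N s. \<Sum>n<N. f n s) (\<lambda>s. suminf (\<lambda>n. f n s)) sequentially"
    if "s \<in> U" for s
  proof -
    \<comment> \<open>Half the distance to the boundary line: on the closed disc of radius
      \<open>d\<close> the decay exponent Re w + j is still at least 1 + d.\<close>
    define d where "d = (Re s - (1 - real j)) / 2"
    have d: "d > 0" using that by (simp add: d_def U_def)
    define C where "C = (\<Prod>i<j. norm s + d + real i)"
    have re: "Re w \<ge> 1 - real j + d" if "w \<in> cball s d" for w
    proof -
      have "\<bar>Re s - Re w\<bar> \<le> d"
        using that abs_Re_le_cmod[of "s - w"] by (simp add: dist_norm)
      then have "Re w \<ge> Re s - d" by linarith
      also have "Re s - d = 1 - real j + d" by (simp add: d_def field_simps)
      finally show ?thesis .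
    qed
    have 1: "cball s d \<subseteq> U" using re d by (force simp: U_def)
    have bound: "norm (f n w) \<le> K * C * real (Suc n) powr (-(1 + d))" if "w \<in> cball s d" for n w
    proof -
      have nw: "norm w \<le> norm s + d"
        using that norm_triangle_ineq2[of w s] by (simp add: dist_norm norm_minus_commute)
      have "norm (powr_diff j w (of_real (real (Suc n)))) \<le>
          (\<Prod>i<j. norm (w + of_nat i)) * real (Suc n) powr (-(Re w + real j))"
        by (rule norm_powr_diff_le) (use re[OF that] d in auto)
      also have "\<dots> \<le> C * real (Suc n) powr (-(1 + d))"
      proof (rule mult_mono)
        show "(\<Prod>i<j. norm (w + of_nat i)) \<le> C" unfolding C_def
          by (intro prod_mono conjI norm_ge_zero order_trans[OF norm_triangle_ineq]) (use nw in simp)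
        show "real (Suc n) powr (-(Re w + real j)) \<le> real (Suc n) powr (-(1 + d))"
          by (rule powr_mono) (use re[OF that] in auto)
        show "0 \<le> C" unfolding C_def using d by (intro prod_nonneg) auto
      qed auto
      finally show ?thesis unfolding f_def norm_mult mult.assoc
        by (intro mult_mono K K0) auto
    qed
    have "summable (\<lambda>n. real (Suc n) powr (-(1 + d)))"
      using d summable_Suc_iff[of "\<lambda>n. real n powr (-(1 + d))"]
      by (simp add: summable_real_powr_iff del: of_nat_Suc)
    then have "summable (\<lambda>n. K * C * real (Suc n) powr (-(1 + d)))" by (rule summable_mult)
    with bound have "uniform_limit (cball s d) (\<lambda>N s. \<Sum>n<N. f n s) (\<lambda>s. suminf (\<lambda>n. f n s)) sequentially"
      by (rule Weierstrass_m_test)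
    with d 1 show ?thesis by blast
  qed
  have "(\<lambda>s. suminf (\<lambda>n. f n s)) holomorphic_on U"
  proof (rule holomorphic_uniform_sequence[OF opU _ loc])
    show "(\<lambda>s. \<Sum>i<n. f i s) holomorphic_on U" for n
      unfolding f_def by (intro holomorphic_intros holomorphic_on_powr_diff) auto
  qed auto
  moreover have "(\<lambda>n. f n s) sums suminf (\<lambda>n. f n s)" if s: "s \<in> U" for s
  proof -
    obtain d where "d > 0"
      and "uniform_limit (cball s d) (\<lambda>N s. \<Sum>n<N. f n s) (\<lambda>s. suminf (\<lambda>n. f n s)) sequentially"
      using loc[OF s] by blast
    then have "(\<lambda>N. \<Sum>n<N. f n s) \<longlonglongrightarrow> suminf (\<lambda>n. f n s)"
      by (intro tendsto_uniform_limitI[where x = s]) auto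
    then show ?thesis by (simp add: sums_def)
  qed
  ultimately show ?thesis using that unfolding U_def f_def by blast
qed

text \<open>Each summation by parts trades a periodic coefficient sequence of mean zero for another one
  and raises the order of the difference, which extends the half plane of convergence by 1.\<close>
lemma powr_diff_series_continuation:
  fixes a :: "nat \<Rightarrow> complex"
  assumes "m > 0" "\<And>n. a (n + m) = a n" "(\<Sum>n<m. a n) = 0"
  shows "\<exists>F. F holomorphic_on {s. Re s > 1 - real j - real k} \<and>
    (\<forall>s. Re s > (if k = 0 then 1 else 0) - real j \<longrightarrow>
      (\<lambda>n. a n * powr_diff j s (of_nat (Suc n))) sums F s)"
  using assms
proof (induction k arbitrary: a j)
  case 0
  obtain K where K: "\<And>n. norm (a n) \<le> K" using periodic_bounded[of m a] 0(1,2) by blast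
  obtain F where "F holomorphic_on {s. Re s > 1 - real j}"
    "\<And>s. Re s > 1 - real j \<Longrightarrow> (\<lambda>n. a n * powr_diff j s (of_nat (Suc n))) sums F s"
    using powr_diff_series_holomorphic[of a K j, OF K] by blast
  then show ?case by (intro exI[of _ F]) auto
next
  case (Suc k)
  obtain A where A: "\<And>n. A (n + m) = A n" "(\<Sum>n<m. A n) = 0" "\<And>n. A (Suc n) - A n = a n"
    using sum_zero_imp_periodic_antidifference[of m a] Suc.prems by blast
  obtain K where K: "\<And>n. norm (A n) \<le> K" using periodic_bounded[of m A] A(1) Suc.prems(1) by blast
  \<comment> \<open>With \<open>a n = A (Suc n) - A n\<close>, summation by parts pairs
    \<open>A (Suc n)\<close> with the negative of the next difference of the powers.\<close>
  define b where "b n = - A (Suc n)" for n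
  have "(\<Sum>n<m. A (Suc n)) = (\<Sum>n<Suc m. A n) - A 0" by (subst sum.lessThan_Suc_shift) simp
  also have "\<dots> = 0" using A(1)[of 0] A(2) by simp
  finally have b: "b (n + m) = b n" "(\<Sum>n<m. b n) = 0" for n
    using A(1)[of "Suc n"] by (simp_all add: b_def sum_negf)
  obtain F where F: "F holomorphic_on {s. Re s > 1 - real (Suc j) - real k}"
    "\<And>s. Re s > (if k = 0 then 1 else 0) - real (Suc j) \<Longrightarrow>
      (\<lambda>n. b n * powr_diff (Suc j) s (of_nat (Suc n))) sums F s"
    using Suc.IH[of b "Suc j", OF Suc.prems(1) b] by blast
  define G where "G s = F s - A 0 * powr_diff j s 1" for s
  have "G holomorphic_on {s. Re s > 1 - real j - real (Suc k)}"
    unfolding G_def using F(1)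
    by (intro holomorphic_intros holomorphic_on_powr_diff) (auto simp: algebra_simps)
  \<comment> \<open>A single summation by parts already shows convergence, not necessarily absolute,
    for Re s > -j; the remaining ones only enlarge the domain of the limit function.\<close>
  moreover have "(\<lambda>n. a n * powr_diff j s (of_nat (Suc n))) sums G s" if s: "Re s > - real j" for s
  proof -
    have part: "(\<Sum>n<N. a n * powr_diff j s (of_nat (Suc n))) =
      A N * powr_diff j s (of_nat (Suc N)) - A 0 * powr_diff j s 1
       + (\<Sum>n<N. b n * powr_diff (Suc j) s (of_nat (Suc n)))" for N
    proof (induction N)
      case (Suc N)
      have "of_nat (Suc N) + 1 = (of_nat (Suc (Suc N)) :: complex)" by simp
      then show ?case unfolding sum.lessThan_Suc Suc unfolding b_def A(3)[symmetric] powr_diff.simps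
        by (simp add: algebra_simps del: of_nat_Suc)
    qed simp
    have lim0: "(\<lambda>N. powr_diff j s (of_nat (Suc N))) \<longlonglongrightarrow> 0"
    proof (rule Lim_null_comparison)
      show "eventually (\<lambda>N. norm (powr_diff j s (of_nat (Suc N))) \<le>
          (\<Prod>i<j. norm (s + of_nat i)) * real (Suc N) powr (-(Re s + real j))) sequentially"
      proof (rule always_eventually, rule allI)
        fix N
        have "norm (powr_diff j s (of_real (real (Suc N)))) \<le>
          (\<Prod>i<j. norm (s + of_nat i)) * real (Suc N) powr (-(Re s + real j))"
          by (rule norm_powr_diff_le) (use s in auto)
        then show "norm (powr_diff j s (of_nat (Suc N))) \<le>
          (\<Prod>i<j. norm (s + of_nat i)) * real (Suc N) powr (-(Re s + real j))" by simp
      qed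
      have "(\<lambda>N. real (Suc N) powr (-(Re s + real j))) \<longlonglongrightarrow> 0"
        by (rule tendsto_neg_powr)
          (use s filterlim_compose[OF filterlim_real_sequentially filterlim_Suc] in auto)
      then show "(\<lambda>N. (\<Prod>i<j. norm (s + of_nat i)) * real (Suc N) powr (-(Re s + real j))) \<longlonglongrightarrow> 0"
        by (rule tendsto_mult_right_zero)
    qed
    have lim: "(\<lambda>N. A N * powr_diff j s (of_nat (Suc N))) \<longlonglongrightarrow> 0"
    proof (rule Lim_null_comparison[where g = "\<lambda>N. K * norm (powr_diff j s (of_nat (Suc N)))"])
      show "eventually (\<lambda>N. norm (A N * powr_diff j s (of_nat (Suc N)))
          \<le> K * norm (powr_diff j s (of_nat (Suc N)))) sequentially"
        unfolding norm_mult by (intro always_eventually allI mult_right_mono K norm_ge_zero)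
    qed (rule tendsto_mult_right_zero, rule tendsto_norm_zero, rule lim0)
    have "(\<lambda>N. \<Sum>n<N. b n * powr_diff (Suc j) s (of_nat (Suc n))) \<longlonglongrightarrow> F s"
      using F(2)[of s] s unfolding sums_def by (simp split: if_splits)
    from tendsto_add[OF tendsto_diff[OF lim tendsto_const[of "A 0 * powr_diff j s 1"]] this]
    show ?thesis unfolding sums_def part G_def by (simp del: powr_diff.simps)
  qed
  ultimately show ?case by auto
qed

text \<open>The continuations to Re s > -k all equal the sum of the series for Re s > 0, so the
  identity theorem makes them agree wherever two of them are defined, and they glue to an entire
  function.\<close>

lemma periodic_dirichlet_series_continuation:
  fixes a :: "nat \<Rightarrow> complex"
  assumes "m > 0" "\<And>n. a (n + m) = a n" "(\<Sum>n<m. a n) = 0"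
  obtains G where "G holomorphic_on UNIV"
    "\<And>s. Re s > 0 \<Longrightarrow> (\<lambda>n. a n * of_nat (Suc n) powr (-s)) sums G s"
proof -
  have "\<forall>k. \<exists>F. F holomorphic_on {s. Re s > - real k} \<and>
    (\<forall>s. Re s > 0 \<longrightarrow> (\<lambda>n. a n * of_nat (Suc n) powr (-s)) sums F s)"
    using powr_diff_series_continuation[OF assms, of 0 "Suc _"] by simp
  then obtain F where F: "\<And>k. F k holomorphic_on {s. Re s > - real k}"
    "\<And>k s. Re s > 0 \<Longrightarrow> (\<lambda>n. a n * of_nat (Suc n) powr (-s)) sums F k s"
    by metis
  have eq: "F k s = F l s" if "k \<le> l" "Re s > - real k" for k l s
  proof (rule analytic_continuation_open[of "{s. Re s > 0}" "{s. Re s > - real k}" "F k" "F l"])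
    show "F l holomorphic_on {s. Re s > - real k}"
      by (rule holomorphic_on_subset[OF F(1)]) (use that in auto)
    show "{s. Re s > 0} \<noteq> {}" by (auto intro: exI[of _ 1])
    show "connected {s. Re s > - real k}"
      by (intro convex_connected convex_halfspace_Re_gt)
    show "F k z = F l z" if "z \<in> {s. Re s > 0}" for z
      using F(2)[of z k] F(2)[of z l] that sums_unique2 by blast
  qed (use that F in \<open>auto simp: open_halfspace_Re_gt\<close>)
  \<comment> \<open>The index exceeds the absolute value of Re s, so \<open>s\<close> lies in the
    half plane on which the chosen \<open>F\<close> is holomorphic.\<close>
  define G where "G s = F (nat \<lceil>\<bar>Re s\<bar> + 1\<rceil>) s" for s
  have G: "G s = F k s" if "Re s > - real k" for k s
  proof (cases "k \<le> nat \<lceil>\<bar>Re s\<bar> + 1\<rceil>")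
    case True
    then show ?thesis using eq[OF True] that by (simp add: G_def)
  next
    case False
    have "Re s > - real (nat \<lceil>\<bar>Re s\<bar> + 1\<rceil>)" by linarith
    then show ?thesis using eq[of "nat \<lceil>\<bar>Re s\<bar> + 1\<rceil>" k s] False by (simp add: G_def)
  qed
  have "G holomorphic_on {s. Re s > - real k}" for k
    using F(1)[of k] by (rule holomorphic_transform) (use G in auto)
  then have "G holomorphic_on (\<Union>k::nat. {s. Re s > - real k})"
    by (intro holomorphic_on_UN_open open_halfspace_Re_gt)
  moreover have "(\<Union>k::nat. {s::complex. Re s > - real k}) = UNIV"
  proof -
    have "Re s > - real (nat \<lceil>\<bar>Re s\<bar> + 1\<rceil>)" for s :: complex by linarith
    then show ?thesis by blast
  qed
  ultimately show ?thesis using F(2)[where k = 0] G[where k = 0] that[of G] by auto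
qed

section \<open>Values of L-functions as sums of series\<close>

text \<open>Two continuations on different domains could meet in a disconnected set and disagree on
  one of its components. An entire one is defined on all of the connected set \<open>S\<close>, so
  the identity theorem, starting from Re z > 1, applies on \<open>S\<close> itself.\<close>

lemma L_function_eqI:
  assumes "dirichlet_continuation c G UNIV"
  shows "L_function s c = G s"
  unfolding L_function_def
proof (rule the_equality)
  show "\<exists>F S. dirichlet_continuation c F S \<and> s \<in> S \<and> F s = G s"
    using assms by blast
  fix v assume "\<exists>F S. dirichlet_continuation c F S \<and> s \<in> S \<and> F s = v"
  then obtain F S where F: "dirichlet_continuation c F S" "s \<in> S" "F s = v" by blast
  have "F s = G s"
  proof (rule analytic_continuation_open[of "{z. Re z > 1}" S F G])
    show "{z. Re z > 1} \<noteq> {}" by (auto intro: exI[of _ 2])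
    show "G holomorphic_on S"
      using assms unfolding dirichlet_continuation_def by (blast intro: holomorphic_on_subset)
    show "F z = G z" if "z \<in> {z. Re z > 1}" for z
      using F(1) assms that sums_unique2 unfolding dirichlet_continuation_def by blast
  qed (use F in \<open>auto simp: dirichlet_continuation_def open_halfspace_Re_gt\<close>)
  then show "v = G s" using F by simp
qed

text \<open>Replaces the continued value by a conditionally convergent series, the form in which all
  later estimates use it.\<close>

lemma L_function_1_periodic:
  fixes c :: "nat \<Rightarrow> complex"
  assumes "m > 0" "\<And>n. c (Suc n + m) = c (Suc n)" "(\<Sum>n<m. c (Suc n)) = 0"
  shows "(\<lambda>n. c (Suc n) / of_nat (Suc n)) sums L_function 1 c"
proof -
  obtain G where G: "G holomorphic_on UNIV"
    "\<And>s. Re s > 0 \<Longrightarrow> (\<lambda>n. c (Suc n) * of_nat (Suc n) powr (-s)) sums G s"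
    using periodic_dirichlet_series_continuation[of m "\<lambda>n. c (Suc n)"] assms by auto
  have "L_function 1 c = G 1"
    by (rule L_function_eqI) (use G in \<open>auto simp: dirichlet_continuation_def\<close>)
  moreover have "(\<lambda>n. c (Suc n) / of_nat (Suc n)) sums G 1"
    using G(2)[of 1] by (simp add: powr_minus field_simps del: of_nat_Suc)
  ultimately show ?thesis by simp
qed

text \<open>The point 2 lies in the half plane of absolute convergence, where every continuation is
  the sum of the series, and the half plane itself is an admissible domain. The value is Euler's sum
  of inverse squares.\<close>

lemma riemann_zeta_2: "riemann_zeta 2 = of_real (pi\<^sup>2 / 6)"
proof -
  have s: "(\<lambda>n. (\<lambda>_. 1) (Suc n) * of_nat (Suc n) powr (- 2)) sums (of_real (pi\<^sup>2 / 6) :: complex)"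
  proof -
    have "(\<lambda>n. complex_of_real (1 / (real n + 1)\<^sup>2)) sums of_real (pi\<^sup>2 / 6)"
      using inverse_squares_sums by (subst sums_of_real_iff) (simp add: add_ac)
    moreover have "complex_of_real (1 / (real n + 1)\<^sup>2) = of_nat (Suc n) powr (- 2)" for n
    proof -
      have "(of_nat (Suc n) :: complex) powr (- 2) = inverse (of_nat (Suc n) powr of_nat 2)"
        by (subst powr_minus) simp
      also have "\<dots> = inverse (of_nat (Suc n) ^ 2)"
        by (subst powr_nat') (simp_all del: of_nat_Suc)
      finally show ?thesis by (simp add: field_simps add_ac)
    qed
    ultimately show ?thesis by simp
  qed
  obtain F where F: "F holomorphic_on {s. Re s > 1}"
    "\<And>s. Re s > 1 \<Longrightarrow> (\<lambda>n. 1 * of_nat (Suc n) powr (-s)) sums F s"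
    using powr_diff_series_holomorphic[of "\<lambda>_. 1" 1 0] by auto
  have cont: "dirichlet_continuation (\<lambda>_. 1) F {s. Re s > 1}"
    using F by (auto simp: dirichlet_continuation_def open_halfspace_Re_gt
        intro!: convex_connected convex_halfspace_Re_gt)
  have val: "F' 2 = of_real (pi\<^sup>2 / 6)"
    if "dirichlet_continuation (\<lambda>_. 1) F' S" for F' S
  proof -
    have "(\<lambda>n. (\<lambda>_. 1) (Suc n) * of_nat (Suc n) powr (- 2)) sums F' 2"
      using that unfolding dirichlet_continuation_def by (elim conjE allE[of _ 2]) simp
    then show ?thesis using s sums_unique2 by blast
  qed
  show ?thesis unfolding riemann_zeta_def L_function_def
  proof (rule the_equality)
    show "\<exists>F S. dirichlet_continuation (\<lambda>_. 1) F S \<and> 2 \<in> S \<and> F 2 = of_real (pi\<^sup>2 / 6)"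
      using cont val[OF cont] by (intro exI[of _ F] exI[of _ "{s. Re s > 1}"]) simp
    fix v assume "\<exists>F S. dirichlet_continuation (\<lambda>_. 1) F S \<and> 2 \<in> S \<and> F 2 = v"
    then obtain F' S where "dirichlet_continuation (\<lambda>_. 1) F' S" "F' 2 = v" by blast
    with val[of F' S] show "v = of_real (pi\<^sup>2 / 6)" by simp
  qed
qed

section \<open>Multiplicative functions and mean values\<close>

definition multiplicative :: "(nat \<Rightarrow> real) \<Rightarrow> bool" where
  "multiplicative f \<longleftrightarrow>
     f 1 = 1 \<and> (\<forall>a b. a > 0 \<longrightarrow> b > 0 \<longrightarrow> coprime a b \<longrightarrow> f (a * b) = f a * f b)"

definition dconv :: "(nat \<Rightarrow> real) \<Rightarrow> (nat \<Rightarrow> real) \<Rightarrow> nat \<Rightarrow> real" where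
  "dconv f g n = (\<Sum>d | d dvd n. f (n div d) * g d)"

lemma multiplicativeD:
  "multiplicative f \<Longrightarrow> a > 0 \<Longrightarrow> b > 0 \<Longrightarrow> coprime a b \<Longrightarrow> f (a * b) = f a * f b"
  by (simp add: multiplicative_def)

text \<open>Splitting off the full power of one prime leaves a smaller, coprime cofactor.
  Multiplicative functions are compared and estimated along this induction.\<close>

lemma prime_power_coprime_induct [consumes 1, case_names one prime_power mult]:
  fixes n :: nat
  assumes "n > 0" and one: "P 1"
    and pp: "\<And>p k. prime p \<Longrightarrow> k > 0 \<Longrightarrow> P (p ^ k)"
    and mult: "\<And>a b. a > 0 \<Longrightarrow> b > 0 \<Longrightarrow> coprime a b \<Longrightarrow> P a \<Longrightarrow> P b \<Longrightarrow> P (a * b)"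
  shows "P n"
  using \<open>n > 0\<close>
proof (induction n rule: less_induct)
  case (less n)
  show ?case
  proof (cases "n = 1")
    case False
    then obtain p where p: "prime p" "p dvd n" using prime_factor_nat by blast
    obtain y where y: "n = p ^ multiplicity p n * y" "\<not> p dvd y"
    proof (rule multiplicity_decompose'[of n p])
      show "n \<noteq> 0" using less.prems by simp
      show "\<not> is_unit p" using p by (simp add: prime_nat_iff)
    qed
    define k where "k = multiplicity p n"
    have k: "k > 0" using p less.prems by (simp add: k_def prime_multiplicity_gt_zero_iff)
    have "y > 0" using y less.prems by (cases "y = 0") auto
    have "p ^ k > 1" using k prime_gt_1_nat[OF p(1)] by (rule one_less_power[rotated])
    then have "1 * y < p ^ k * y" using \<open>y > 0\<close> by (intro mult_strict_right_mono)
    then have "y < n" using y(1) by (simp add: k_def)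
    have "coprime (p ^ k) y" using y(2) p by (simp add: prime_imp_coprime coprime_power_left_iff)
    then show ?thesis
      using mult[of "p ^ k" y] pp[OF p(1) k] less.IH[OF \<open>y < n\<close> \<open>y > 0\<close>] \<open>y > 0\<close> y(1) p
      by (simp add: k_def prime_gt_0_nat)
  qed (use one in simp)
qed

lemma multiplicative_eqI:
  assumes "multiplicative f" "multiplicative g" "n > 0"
    and "\<And>p k. prime p \<Longrightarrow> k > 0 \<Longrightarrow> f (p ^ k) = g (p ^ k)"
  shows "f n = g n"
  using \<open>n > 0\<close>
  by (induction n rule: prime_power_coprime_induct) (use assms in \<open>auto simp: multiplicative_def\<close>)

text \<open>The inverse sends x to (gcd x a, gcd x b): a divisor of one factor is coprime to the
  other factor, so each gcd recovers its own component.\<close>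

lemma bij_betw_divisors_mult:
  fixes a b :: nat
  assumes "coprime a b"
  shows "bij_betw (\<lambda>(d, e). d * e) ({d. d dvd a} \<times> {e. e dvd b}) {d. d dvd a * b}"
proof (rule bij_betw_byWitness[where f' = "\<lambda>x. (gcd x a, gcd x b)"])
  have *: "gcd (d * e) a = d \<and> gcd (d * e) b = e" if "d dvd a" "e dvd b" for d e
  proof -
    have "coprime e a" "coprime d b"
      using assms that by (meson coprime_commute coprime_divisors dvd_refl)+
    then have "gcd (d * e) a = gcd d a" "gcd (d * e) b = gcd e b"
      by (simp_all add: gcd_mult_left_left_cancel gcd_mult_left_right_cancel coprime_commute)
    then show ?thesis using that by (simp add: gcd_nat.absorb1)
  qed
  show "\<forall>x\<in>{d. d dvd a} \<times> {e. e dvd b}. (\<lambda>x. (gcd x a, gcd x b)) ((\<lambda>(d, e). d * e) x) = x"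
    using * by auto
  show "\<forall>x\<in>{d. d dvd a * b}. (\<lambda>(d, e). d * e) (gcd x a, gcd x b) = x"
  proof
    fix x assume "x \<in> {d. d dvd a * b}"
    then obtain d e where "x = d * e" "d dvd a" "e dvd b" using division_decomp by blast
    then show "(\<lambda>(d, e). d * e) (gcd x a, gcd x b) = x" using * by simp
  qed
qed (auto intro: mult_dvd_mono)

lemma multiplicative_dconv:
  assumes f: "multiplicative f" and g: "multiplicative g"
  shows "multiplicative (dconv f g)"
  unfolding multiplicative_def
proof (intro conjI allI impI)
  show "dconv f g 1 = 1" using assms by (simp add: dconv_def multiplicative_def)
next
  fix a b :: nat assume ab: "a > 0" "b > 0" "coprime a b"
  have "dconv f g (a * b) =
    (\<Sum>(d, e)\<in>{d. d dvd a} \<times> {e. e dvd b}. f (a * b div (d * e)) * g (d * e))"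
    unfolding dconv_def
    by (subst sum.reindex_bij_betw[OF bij_betw_divisors_mult[OF ab(3)], symmetric])
      (simp add: case_prod_unfold)
  also have "\<dots> = (\<Sum>(d, e)\<in>{d. d dvd a} \<times> {e. e dvd b}. (f (a div d) * g d) * (f (b div e) * g e))"
  proof (intro sum.cong refl, clarify)
    fix d e assume de: "d dvd a" "e dvd b"
    have pos: "d > 0" "e > 0" using de ab by (auto intro: dvd_pos_nat)
    have "a * b div (d * e) = (a div d) * (b div e)" using de by (simp add: div_mult_div_if_dvd)
    moreover have "coprime (a div d) (b div e)" "coprime d e"
      using de by (auto intro!: coprime_divisors[OF _ _ ab(3)] intro: dvdI[of a _ d] dvdI[of b _ e])
    moreover have "a div d > 0" "b div e > 0" using de ab pos by (auto simp: div_greater_zero_iff dvd_imp_le)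
    ultimately show "f (a * b div (d * e)) * g (d * e) = (f (a div d) * g d) * (f (b div e) * g e)"
      using f g pos by (simp add: multiplicativeD)
  qed
  also have "\<dots> = dconv f g a * dconv f g b"
    unfolding dconv_def sum_product sum.cartesian_product ..
  finally show "dconv f g (a * b) = dconv f g a * dconv f g b" .
qed

lemma dconv_prime_power:
  assumes "prime p"
  shows "dconv f g (p ^ k) = (\<Sum>i\<le>k. f (p ^ (k - i)) * g (p ^ i))"
proof -
  have p: "p > 1" using assms prime_gt_1_nat by blast
  have "{d. d dvd p ^ k} = (\<lambda>i. p ^ i) ` {..k}"
    using divides_primepow_nat[OF assms] by auto
  moreover have "inj_on (\<lambda>i. p ^ i) {..k}" using p by (auto simp: inj_on_def)
  ultimately show ?thesis unfolding dconv_def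
    by (simp add: sum.reindex) (use p in \<open>auto intro!: sum.cong simp: power_diff\<close>)
qed

text \<open>Both correcting factors, \<open>moebius_sqrt\<close> and \<open>factor_at_2\<close>,
  vanish at p^i for i >= 3, so convolving with them at p^k leaves at most three terms.\<close>

lemma sum_conv_short_support:
  fixes u w :: "nat \<Rightarrow> real"
  assumes "\<And>i. i \<ge> 3 \<Longrightarrow> w i = 0"
  shows "(\<Sum>i\<le>k. u (k - i) * w i) =
    u k * w 0 + (if k \<ge> 1 then u (k - 1) * w 1 else 0) + (if k \<ge> 2 then u (k - 2) * w 2 else 0)"
proof -
  have "(\<Sum>i\<le>k. u (k - i) * w i) = (\<Sum>i\<in>{0,1,2} \<inter> {..k}. u (k - i) * w i)"
    by (rule sum.mono_neutral_right) (use assms in \<open>force simp: not_le\<close>)+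
  also have "\<dots> = (\<Sum>i\<in>{0,1,2}. if i \<le> k then u (k - i) * w i else 0)"
    by (subst sum.inter_restrict) auto
  finally show ?thesis by simp
qed

section \<open>Mean values of Dirichlet convolutions\<close>

definition mean_value :: "(nat \<Rightarrow> real) \<Rightarrow> real \<Rightarrow> bool" where
  "mean_value f L \<longleftrightarrow> (\<lambda>N. (\<Sum>n=1..N. f n) / real N) \<longlonglongrightarrow> L"

lemma mean_value_cong:
  assumes "\<And>n. n > 0 \<Longrightarrow> f n = g n"
  shows "mean_value f L \<longleftrightarrow> mean_value g L"
proof -
  have "(\<Sum>n=1..N. f n) = (\<Sum>n=1..N. g n)" for N
    by (rule sum.cong) (use assms in auto)
  then show ?thesis by (simp add: mean_value_def)
qed

lemma mean_value_unique: "mean_value f L \<Longrightarrow> mean_value f L' \<Longrightarrow> L = L'"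
  unfolding mean_value_def by (rule LIMSEQ_unique)

lemma mean_value_1: "mean_value (\<lambda>_. 1) 1"
  unfolding mean_value_def
  by (rule tendsto_eventually) (auto intro: eventually_mono[OF eventually_gt_at_top[of 0]])

text \<open>Both sides run over the pairs (d, e) of positive integers with d e <= N, grouped by the
  product or by d. The summand may depend on both variables because the Lambert series in the proof
  that L(1) is not 0 is also rearranged this way.\<close>

lemma sum_divisors_swap:
  fixes \<phi> :: "nat \<Rightarrow> nat \<Rightarrow> real"
  shows "(\<Sum>n=1..N. \<Sum>d | d dvd n. \<phi> d (n div d)) = (\<Sum>d=1..N. \<Sum>e=1..N div d. \<phi> d e)"
proof -
  have "(\<Sum>n=1..N. \<Sum>d | d dvd n. \<phi> d (n div d)) =
      (\<Sum>n=1..N. \<Sum>d=1..N. if d dvd n then \<phi> d (n div d) else 0)"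
  proof (rule sum.cong)
    fix n assume n: "n \<in> {1..N}"
    have "{d. d dvd n} = {d \<in> {1..N}. d dvd n}"
      using n by (auto dest: dvd_imp_le intro: dvd_pos_nat simp: Suc_le_eq)
    then show "(\<Sum>d | d dvd n. \<phi> d (n div d)) = (\<Sum>d=1..N. if d dvd n then \<phi> d (n div d) else 0)"
      by (simp only: sum.inter_filter finite_atLeastAtMost)
  qed simp
  also have "\<dots> = (\<Sum>d=1..N. \<Sum>n=1..N. if d dvd n then \<phi> d (n div d) else 0)"
    by (rule sum.swap)
  also have "\<dots> = (\<Sum>d=1..N. \<Sum>e=1..N div d. \<phi> d e)"
  proof (rule sum.cong)
    fix d assume d: "d \<in> {1..N}"
    have "(\<Sum>n=1..N. if d dvd n then \<phi> d (n div d) else 0)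
      = (\<Sum>n | n \<in> {1..N} \<and> d dvd n. \<phi> d (n div d))"
      by (simp only: sum.inter_filter finite_atLeastAtMost)
    also have "\<dots> = (\<Sum>e=1..N div d. \<phi> d e)"
    proof (rule sum.reindex_bij_witness[where i = "\<lambda>e. d * e" and j = "\<lambda>n. n div d"])
      fix e assume e: "e \<in> {1..N div d}"
      then show "d * e \<in> {n. n \<in> {1..N} \<and> d dvd n}"
        using d by (auto simp: less_eq_div_iff_mult_less_eq mult.commute)
      show "d * e div d = e" using d by simp
    next
      fix n assume "n \<in> {n. n \<in> {1..N} \<and> d dvd n}"
      then show "d * (n div d) = n" "n div d \<in> {1..N div d}"
        using d by (auto simp: div_le_mono Suc_le_eq div_greater_zero_iff dvd_imp_le)
    qed simp
    finally show "(\<Sum>n=1..N. if d dvd n then \<phi> d (n div d) else 0) = (\<Sum>e=1..N div d. \<phi> d e)" .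
  qed simp
  finally show ?thesis .
qed

lemma sum_dconv:
  "(\<Sum>n=1..N. dconv f g n) = (\<Sum>d=1..N. g d * (\<Sum>e=1..N div d. f e))"
  unfolding dconv_def sum_divisors_swap[where \<phi> = "\<lambda>d e. f e * g d"]
  by (simp add: sum_distrib_left mult.commute)

lemma tendsto_nat_div_over: "k > 0 \<Longrightarrow> (\<lambda>N. real (N div k) / real N) \<longlonglongrightarrow> 1 / real k"
proof (rule tendsto_sandwich[where f = "\<lambda>N. 1 / real k - 1 / real N" and h = "\<lambda>_. 1 / real k"])
  assume k: "k > 0"
  show "eventually (\<lambda>N. 1 / real k - 1 / real N \<le> real (N div k) / real N) sequentially"
  proof (rule eventually_mono[OF eventually_gt_at_top[of 0]])
    fix N :: nat assume N: "N > 0"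
    have "real N / real k - 1 \<le> real (N div k)"
      using floor_divide_of_nat_eq[of N k, where 'a = real] by linarith
    then have "(real N / real k - 1) / real N \<le> real (N div k) / real N"
      by (rule divide_right_mono) simp
    then show "1 / real k - 1 / real N \<le> real (N div k) / real N"
      using N by (simp add: diff_divide_distrib)
  qed
  show "eventually (\<lambda>N. real (N div k) / real N \<le> 1 / real k) sequentially"
  proof (rule eventually_mono[OF eventually_gt_at_top[of 0]])
    fix N :: nat assume N: "N > 0"
    have "real (N div k) \<le> real N / real k" by (rule of_nat_div_le_of_nat)
    then show "real (N div k) / real N \<le> 1 / real k" using N k by (simp add: field_simps)
  qed
  show "(\<lambda>N. 1 / real k - 1 / real N) \<longlonglongrightarrow> 1 / real k"
    using tendsto_diff[OF tendsto_const lim_1_over_n] by simp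
qed simp

text \<open>The average up to N is the sum over k of \<open>g k * F (N div k) / real N\<close>,
  where \<open>F\<close> is the summatory function of f. For fixed k the term tends to L g(k) / k,
  and \<open>F\<close> grows at most linearly, so a multiple of |g(k)| / k dominates and Tannery's
  theorem exchanges limit and sum.\<close>

lemma mean_value_dconv:
  assumes f: "mean_value f L" and g: "summable (\<lambda>n. \<bar>g n\<bar> / real n)"
  shows "mean_value (dconv f g) (L * (\<Sum>n. g n / real n))"
proof -
  define F where "F N = (\<Sum>n=1..N. f n)" for N
  have lim: "(\<lambda>N. F N / real N) \<longlonglongrightarrow> L" using f by (simp add: mean_value_def F_def)
  then obtain B where B: "\<And>N. norm (F N / real N) \<le> B" "B > 0"
    using convergent_imp_Bseq[OF convergentI[OF lim]] unfolding Bseq_def by blast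
  have F: "\<bar>F N\<bar> \<le> B * real N" for N
    using B(1)[of N] by (cases "N = 0") (auto simp: F_def field_simps abs_mult)
  define a where "a k N = g k * F (N div k) / real N" for k N
  have "(\<lambda>N. suminf (\<lambda>k. a k N)) \<longlonglongrightarrow> (\<Sum>k. L * (g k / real k))"
  proof (rule tannerys_theorem[THEN conjunct2, THEN conjunct2])
    fix k
    show "(\<lambda>N. a k N) \<longlonglongrightarrow> L * (g k / real k)"
    proof (cases "k = 0")
      case False
      have "filterlim (\<lambda>N. N div k) sequentially sequentially"
        using False by (intro filterlim_at_top_div_const_nat) simp
      from filterlim_compose[OF lim this] tendsto_nat_div_over[of k] False
      have "(\<lambda>N. g k * (F (N div k) / real (N div k) * (real (N div k) / real N))) \<longlonglongrightarrow> g k * (L * (1 / real k))"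
        by (intro tendsto_mult tendsto_const) auto
      moreover have "a k N = g k * (F (N div k) / real (N div k) * (real (N div k) / real N))" for N
        by (cases "N div k = 0") (auto simp: a_def F_def)
      ultimately show ?thesis by (simp add: field_simps)
    qed (simp add: a_def F_def)
    have "norm (a k N) \<le> B * (\<bar>g k\<bar> / real k)" for k N
    proof (cases "N = 0 \<or> k = 0")
      case False
      have "\<bar>F (N div k)\<bar> \<le> B * (real N / real k)"
        using F[of "N div k"] of_nat_div_le_of_nat[of N k, where 'a = real] B(2)
        by (meson mult_left_mono order_trans less_imp_le)
      then have "\<bar>g k\<bar> * \<bar>F (N div k)\<bar> / real N \<le> \<bar>g k\<bar> * (B * (real N / real k)) / real N"
        by (intro divide_right_mono mult_left_mono) auto
      then show ?thesis using False by (simp add: a_def abs_mult mult_ac)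
    qed (use B in \<open>auto simp: a_def F_def\<close>)
    then show "eventually (\<lambda>(k, N). norm (a k N) \<le> B * (\<bar>g k\<bar> / real k)) (at_top \<times>\<^sub>F sequentially)"
      by (intro always_eventually) auto
  qed (rule summable_mult[OF g], simp)
  also have "(\<Sum>k. L * (g k / real k)) = L * (\<Sum>k. g k / real k)"
    by (rule suminf_mult) (rule summable_rabs_cancel, use g in simp)
  also have "(\<lambda>N. suminf (\<lambda>k. a k N)) = (\<lambda>N. (\<Sum>n=1..N. dconv f g n) / real N)"
  proof
    fix N
    have "suminf (\<lambda>k. a k N) = (\<Sum>k=1..N. a k N)"
    proof (rule suminf_finite)
      fix k assume "k \<notin> {1..N}"
      then have "N div k = 0" by (cases "k = 0") auto
      then show "a k N = 0" by (simp add: a_def F_def)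
    qed simp
    then show "suminf (\<lambda>k. a k N) = (\<Sum>n=1..N. dconv f g n) / real N"
      unfolding sum_dconv sum_divide_distrib by (simp add: a_def F_def)
  qed
  finally show ?thesis by (simp add: mean_value_def)
qed

section \<open>Squares, squarefree numbers and the constant 1/zeta(2)\<close>

definition square_ind :: "nat \<Rightarrow> real" where
  "square_ind n = of_bool (is_square n)"

text \<open>Supported on the squares \<open>m\<^sup>2\<close>, where its value is the Moebius function of \<open>m\<close>.\<close>
definition moebius_sqrt :: "nat \<Rightarrow> real" where
  "moebius_sqrt n = (\<Prod>p\<in>prime_factors n. if multiplicity p n = 2 then - 1 else 0)"

lemma multiplicative_1: "multiplicative (\<lambda>_. 1)"
  by (simp add: multiplicative_def)

lemma multiplicative_square_ind: "multiplicative square_ind"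
  by (auto simp: multiplicative_def square_ind_def is_nth_power_mult_coprime_nat_iff)

lemma square_ind_prime_power: "prime p \<Longrightarrow> square_ind (p ^ k) = of_bool (even k)"
  by (simp add: square_ind_def is_nth_power_prime_power_nat_iff)

lemma multiplicative_moebius_sqrt: "multiplicative moebius_sqrt"
  unfolding multiplicative_def
proof (intro conjI allI impI)
  fix a b :: nat assume ab: "a > 0" "b > 0" "coprime a b"
  have disj: "prime_factors a \<inter> prime_factors b = {}"
    using ab(3) by (auto simp: in_prime_factors_iff dest: coprime_common_divisor_nat)
  have 1: "multiplicity p (a * b) = multiplicity p a" if "p \<in> prime_factors a" for p
  proof -
    have "\<not> p dvd b" using that disj ab by (auto simp: in_prime_factors_iff)
    then show ?thesis using that ab
      by (simp add: prime_elem_multiplicity_mult_distrib in_prime_factors_iff not_dvd_imp_multiplicity_0)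
  qed
  have 2: "multiplicity p (a * b) = multiplicity p b" if "p \<in> prime_factors b" for p
  proof -
    have "\<not> p dvd a" using that disj ab by (auto simp: in_prime_factors_iff)
    then show ?thesis using that ab
      by (simp add: prime_elem_multiplicity_mult_distrib in_prime_factors_iff not_dvd_imp_multiplicity_0)
  qed
  have "prime_factors (a * b) = prime_factors a \<union> prime_factors b"
    using ab by (simp add: prime_factors_product)
  then have "moebius_sqrt (a * b) =
      (\<Prod>p\<in>prime_factors a. if multiplicity p (a * b) = 2 then - 1 else 0) *
      (\<Prod>p\<in>prime_factors b. if multiplicity p (a * b) = 2 then - 1 else 0)"
    unfolding moebius_sqrt_def using disj by (simp add: prod.union_disjoint)
  also have "\<dots> = moebius_sqrt a * moebius_sqrt b"
    unfolding moebius_sqrt_def by (intro arg_cong2[where f = "(*)"] prod.cong) (auto simp: 1 2)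
  finally show "moebius_sqrt (a * b) = moebius_sqrt a * moebius_sqrt b" .
qed (simp add: moebius_sqrt_def)

lemma moebius_sqrt_prime_power:
  assumes "prime p"
  shows "moebius_sqrt (p ^ k) = (if k = 0 then 1 else if k = 2 then -1 else 0)"
proof (cases "k = 0")
  case False
  then show ?thesis using assms
    by (simp add: moebius_sqrt_def prime_factors_power prime_prime_factors
        prime_elem_multiplicity_power_distrib)
qed (simp add: moebius_sqrt_def)

lemma square_ind_nonneg: "square_ind n \<ge> 0"
  by (simp add: square_ind_def)

lemma abs_moebius_sqrt_le: "n > 0 \<Longrightarrow> \<bar>moebius_sqrt n\<bar> \<le> square_ind n"
proof (induction n rule: prime_power_coprime_induct)
  case one
  then show ?case using multiplicative_moebius_sqrt multiplicative_square_ind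
    by (simp add: multiplicative_def)
next
  case (prime_power p k)
  then show ?case by (simp add: moebius_sqrt_prime_power square_ind_prime_power)
next
  case (mult a b)
  then show ?case
    using mult_mono[OF mult.IH]
    by (simp add: multiplicativeD[OF multiplicative_moebius_sqrt]
        multiplicativeD[OF multiplicative_square_ind] abs_mult square_ind_nonneg)
qed

lemma square_ind_sums: "(\<lambda>n. square_ind n / real n) sums (pi\<^sup>2 / 6)"
proof -
  have "(\<lambda>n. (\<lambda>n. square_ind n / real n) ((n + 1)\<^sup>2)) sums (pi\<^sup>2 / 6) \<longleftrightarrow>
    (\<lambda>n. square_ind n / real n) sums (pi\<^sup>2 / 6)"
  proof (rule sums_mono_reindex)
    show "strict_mono (\<lambda>n::nat. (n + 1)\<^sup>2)" by (auto simp: strict_mono_def intro: power_strict_mono)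
    fix n assume n: "n \<notin> range (\<lambda>n::nat. (n + 1)\<^sup>2)"
    show "square_ind n / real n = 0"
    proof (cases "is_square n")
      case True
      then obtain m where "n = m\<^sup>2" by (auto simp: is_nth_power_def)
      \<comment> \<open>The number 0 is a square outside the range of the reindexing; its term
        vanishes since division by 0 gives 0.\<close>
      with n have "m = 0" by (cases m) auto
      with \<open>n = m\<^sup>2\<close> show ?thesis by simp
    qed (simp add: square_ind_def)
  qed
  moreover have "square_ind ((n + 1)\<^sup>2) = 1" for n by (simp add: square_ind_def)
  ultimately show ?thesis using inverse_squares_sums by (simp add: add_ac)
qed

lemma summable_moebius_sqrt: "summable (\<lambda>n. \<bar>moebius_sqrt n\<bar> / real n)"
proof (rule summable_comparison_test')
  show "summable (\<lambda>n. square_ind n / real n)" using square_ind_sums by (rule sums_summable)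
  show "norm (\<bar>moebius_sqrt n\<bar> / real n) \<le> square_ind n / real n" if "n \<ge> 1" for n
    using abs_moebius_sqrt_le[of n] that by (simp add: divide_right_mono)
qed

text \<open>Convolving 1 with \<open>moebius_sqrt\<close> gives the indicator of the squarefree
  numbers. Every positive integer is uniquely a square times a squarefree number, so a further
  convolution with \<open>square_ind\<close> gives 1 again. The mean value of 1, computed in both
  ways, shows that the sum sought times pi^2 / 6 is 1.\<close>

lemma suminf_moebius_sqrt: "(\<Sum>n. moebius_sqrt n / real n) = 6 / pi\<^sup>2"
proof -
  let ?M = "\<Sum>n. moebius_sqrt n / real n"
  have "mean_value (dconv (dconv (\<lambda>_. 1) moebius_sqrt) square_ind)
      (1 * ?M * (\<Sum>n. square_ind n / real n))"
    using sums_summable[OF square_ind_sums]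
    by (intro mean_value_dconv mean_value_1 summable_moebius_sqrt) (simp add: square_ind_def)
  moreover have "dconv (dconv (\<lambda>_. 1) moebius_sqrt) square_ind n = 1" if "n > 0" for n
  proof (rule multiplicative_eqI[OF _ multiplicative_1 that])
    fix p k :: nat assume p: "prime p"
    have A: "dconv (\<lambda>_. 1) moebius_sqrt (p ^ j) = (if j \<le> 1 then 1 else 0)" for j
      unfolding dconv_prime_power[OF p] moebius_sqrt_prime_power[OF p]
      by (subst sum_conv_short_support[of _ "\<lambda>_. 1"]) auto
    have "dconv (dconv (\<lambda>_. 1) moebius_sqrt) square_ind (p ^ k) =
        (\<Sum>i\<le>k. if even i \<and> k - i \<le> 1 then 1 else 0)"
      unfolding dconv_prime_power[OF p, of _ square_ind] A square_ind_prime_power[OF p]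
      by (intro sum.cong) auto
    \<comment> \<open>The only even i in {k - 1, k} is the largest even number not exceeding
      k.\<close>
    also have "\<dots> = (\<Sum>i\<le>k. if i = 2 * (k div 2) then 1 else 0)"
    proof (intro sum.cong refl)
      fix i assume "i \<in> {..k}"
      then have "even i \<and> k - i \<le> 1 \<longleftrightarrow> i = 2 * (k div 2)" by (simp only: atMost_iff) presburger
      then show "(if even i \<and> k - i \<le> 1 then 1 else 0) = (if i = 2 * (k div 2) then 1 else (0::real))"
        by simp
    qed
    also have "\<dots> = 1" by simp
    finally show "dconv (dconv (\<lambda>_. 1) moebius_sqrt) square_ind (p ^ k) = 1" .
  qed (intro multiplicative_dconv multiplicative_1 multiplicative_moebius_sqrt multiplicative_square_ind)
  ultimately have "mean_value (\<lambda>_. 1) (1 * ?M * (\<Sum>n. square_ind n / real n))"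
    by (subst (asm) mean_value_cong[where g = "\<lambda>_. 1"]) auto
  then have "?M * (pi\<^sup>2 / 6) = 1"
    using mean_value_unique[OF mean_value_1] sums_unique[OF square_ind_sums] by simp
  then show ?thesis by (simp add: field_simps)
qed

section \<open>Real characters and the value at 1\<close>

text \<open>Abel summation: the decrements of \<open>b\<close> telescope and contribute at most K (b
  a - b N), the two boundary terms at most K b N and K b a; together this is 2 K b a.\<close>

lemma abel_antimono_bound:
  fixes c b :: "nat \<Rightarrow> real"
  assumes K: "\<And>n. \<bar>\<Sum>i<n. c i\<bar> \<le> K" and "a \<le> N"
    and dec: "\<And>i. a \<le> i \<Longrightarrow> i < N \<Longrightarrow> b (Suc i) \<le> b i" and "b N \<ge> 0"
  shows "\<bar>\<Sum>i=a..<N. c i * b i\<bar> \<le> 2 * K * b a"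
proof -
  define S where "S n = (\<Sum>i<n. c i)" for n
  have S: "\<bar>S n\<bar> \<le> K" for n using K by (simp add: S_def)
  have "\<bar>(\<Sum>i=a..<N. c i * b i) - S N * b N + S a * b a\<bar> \<le> K * (b a - b N)"
    using \<open>a \<le> N\<close> dec
  proof (induction N rule: dec_induct)
    case (step n)
    have "(\<Sum>i=a..<Suc n. c i * b i) - S (Suc n) * b (Suc n) + S a * b a =
        ((\<Sum>i=a..<n. c i * b i) - S n * b n + S a * b a) + S (Suc n) * (b n - b (Suc n))"
      using step.hyps by (simp add: S_def algebra_simps)
    also have "\<bar>\<dots>\<bar> \<le> \<bar>(\<Sum>i=a..<n. c i * b i) - S n * b n + S a * b a\<bar> + \<bar>S (Suc n) * (b n - b (Suc n))\<bar>"
      by (rule abs_triangle_ineq)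
    also have "\<dots> \<le> K * (b a - b n) + K * (b n - b (Suc n))"
    proof (rule add_mono)
      show "\<bar>S (Suc n) * (b n - b (Suc n))\<bar> \<le> K * (b n - b (Suc n))"
        using step.prems[of n] step.hyps S[of "Suc n"] by (simp add: abs_mult mult_right_mono)
    qed (use step in auto)
    finally show ?case by (simp add: algebra_simps)
  qed simp
  moreover have "b a \<ge> b N"
    using \<open>a \<le> N\<close> dec by (induction N rule: dec_induct) (auto intro: order_trans)
  then have "\<bar>S N * b N\<bar> \<le> K * b N" "\<bar>S a * b a\<bar> \<le> K * b a"
    using S \<open>b N \<ge> 0\<close> by (auto simp: abs_mult intro!: mult_right_mono)
  ultimately show ?thesis by (simp add: algebra_simps)
qed

text \<open>A real nonprincipal Dirichlet character, nonprincipality being expressed by the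
  vanishing sum over a period. The locale serves both families of Kronecker characters, with periods
  |q| and 4 |q|.\<close>

locale real_character =
  fixes c :: "nat \<Rightarrow> real" and m :: nat
  assumes m_pos: "m > 0"
    and periodic: "\<And>n. c (n + m) = c n"
    and sum_period: "(\<Sum>n<m. c n) = 0"
    and one: "c 1 = 1"
    and mult: "\<And>a b. a > 0 \<Longrightarrow> b > 0 \<Longrightarrow> c (a * b) = c a * c b"
    and range: "\<And>n. c n \<in> {-1, 0, 1}"
begin

lemma power: "p > 0 \<Longrightarrow> c (p ^ k) = c p ^ k"
  by (induction k) (use one in \<open>auto simp: mult\<close>)

lemma multiplicative: "multiplicative c"
  using one mult by (simp add: multiplicative_def)

lemma abs_le_1: "\<bar>c n\<bar> \<le> 1"
  using range[of n] by auto

lemma partial_sums_bounded: obtains K where "K > 0" "\<And>n. \<bar>\<Sum>i<n. c i\<bar> \<le> K"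
proof -
  have "(\<Sum>i<n + m. c i) = (\<Sum>i<n. c i)" for n
    by (induction n) (simp_all add: sum_period periodic)
  from periodic_bounded[of m "\<lambda>n. \<Sum>i<n. c i", OF m_pos this] that show ?thesis by auto
qed

definition L1 :: real where "L1 = (\<Sum>n. c n / real n)"

lemma sums_L1: "(\<lambda>n. c n / real n) sums L1"
  and L_function_eq: "L_function 1 (\<lambda>n. of_real (c n)) = of_real L1"
proof -
  \<comment> \<open>The Dirichlet series starts at index 1, so its period runs over 1, ..., m
    instead of 0, ..., m - 1; the two sums agree because c takes the same value at 0 and m.\<close>
  have "(\<Sum>n<m. complex_of_real (c (Suc n))) = of_real ((\<Sum>n<Suc m. c n) - c 0)"
    by (subst sum.lessThan_Suc_shift) simp
  also have "\<dots> = 0" using sum_period periodic[of 0] by simp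
  finally have s: "(\<lambda>n. of_real (c (Suc n)) / of_nat (Suc n)) sums L_function 1 (\<lambda>n. of_real (c n))"
    using periodic[of "Suc _"] by (intro L_function_1_periodic[OF m_pos]) auto
  from sums_Re[OF this] have "(\<lambda>n. c (Suc n) / real (Suc n)) sums Re (L_function 1 (\<lambda>n. of_real (c n)))"
    by (simp add: Re_divide_of_nat del: of_nat_Suc)
  then have *: "(\<lambda>n. c n / real n) sums Re (L_function 1 (\<lambda>n. of_real (c n)))"
    by (subst (asm) sums_Suc_iff) simp
  then show "(\<lambda>n. c n / real n) sums L1" unfolding L1_def by (rule summable_sums[OF sums_summable])
  from * have "(\<lambda>n. c (Suc n) / real (Suc n)) sums L1"
    unfolding L1_def by (subst sums_Suc_iff) (simp add: sums_iff)
  from sums_of_real[OF this, where 'a = complex] s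
  show "L_function 1 (\<lambda>n. of_real (c n)) = of_real L1"
    by (simp add: sums_unique2 del: of_nat_Suc)
qed

lemma L1_partial_sums: "(\<lambda>N. \<Sum>d=1..N. c d / real d) \<longlonglongrightarrow> L1"
proof -
  have "(\<lambda>N. \<Sum>d<Suc N. c d / real d) \<longlonglongrightarrow> L1"
    using sums_L1 unfolding sums_def by (rule LIMSEQ_Suc)
  moreover have "(\<Sum>d<Suc N. c d / real d) = (\<Sum>d=1..N. c d / real d)" for N
    by (intro sum.mono_neutral_right) (auto simp: Suc_le_eq)
  ultimately show ?thesis by simp
qed

text \<open>The series of c(d) / d converges only conditionally, which puts this case beyond
  \<open>mean_value_dconv\<close>. The sum over d of c(d) (N div d) is cut at a fixed D: below, N
  div d is replaced by N / d at total cost at most D; above, N div d is antitone in d and Abel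
  summation bounds the tail by 2 K N / (D + 1).\<close>

lemma mean_value_divisor_sum: "mean_value (dconv (\<lambda>_. 1) c) L1"
  unfolding mean_value_def
proof (rule LIMSEQ_I)
  fix r :: real assume r: "r > 0"
  obtain K where K: "K > 0" "\<And>n. \<bar>\<Sum>i<n. c i\<bar> \<le> K" using partial_sums_bounded by blast
  have "(\<lambda>D. 2 * K / real (Suc D)) \<longlonglongrightarrow> 0"
    using LIMSEQ_Suc[OF lim_const_over_n[of "2 * K"]] .
  then have "eventually (\<lambda>D. 2 * K / real (Suc D) < r / 3) sequentially"
    using r by (intro order_tendstoD) auto
  moreover have "eventually (\<lambda>D. \<bar>(\<Sum>d=1..D. c d / real d) - L1\<bar> < r / 3) sequentially"
    using tendstoD[OF L1_partial_sums, of "r / 3"] r by (simp add: dist_real_def)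
  ultimately obtain D where D: "2 * K / real (Suc D) < r / 3" "\<bar>(\<Sum>d=1..D. c d / real d) - L1\<bar> < r / 3"
    using eventually_happens'[OF sequentially_bot eventually_conj] by blast
  \<comment> \<open>The last summand yields D / N < r / 3, the others N > D.\<close>
  define N0 where "N0 = D + 1 + nat \<lceil>3 * real D / r\<rceil>"
  show "\<exists>N0. \<forall>N\<ge>N0. norm ((\<Sum>n=1..N. dconv (\<lambda>_. 1) c n) / real N - L1) < r"
  proof (intro exI[of _ N0] allI impI)
    fix N assume N: "N \<ge> N0"
    have "real N > 3 * real D / r" "N > D" using N unfolding N0_def by linarith+
    then have ND: "real D / real N < r / 3" "N > D" using r by (simp_all add: field_simps)
    have "(\<Sum>n=1..N. dconv (\<lambda>_. 1) c n) = (\<Sum>d=1..N. c d * real (N div d))"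
      unfolding sum_dconv by simp
    also have "\<dots> = (\<Sum>d=1..D. c d * real (N div d)) + (\<Sum>d=Suc D..<Suc N. c d * real (N div d))"
      using ND(2) sum.ub_add_nat[of 1 D "\<lambda>d. c d * real (N div d)" "N - D"]
      by (simp add: atLeastLessThanSuc_atLeastAtMost)
    finally have split: "(\<Sum>n=1..N. dconv (\<lambda>_. 1) c n) / real N - (\<Sum>d=1..D. c d / real d)
      = (\<Sum>d=1..D. c d * (real (N div d) / real N - 1 / real d))
        + (\<Sum>d=Suc D..<Suc N. c d * real (N div d)) / real N"
      by (simp add: add_divide_distrib sum_divide_distrib right_diff_distrib sum_subtractf)
    have "\<bar>\<Sum>d=1..D. c d * (real (N div d) / real N - 1 / real d)\<bar> \<le> (\<Sum>d=1..D. 1 / real N)"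
    proof (rule order_trans[OF sum_abs sum_mono])
      fix d assume d: "d \<in> {1..D}"
      have "real (N div d) \<le> real N / real d" "real N / real d - 1 \<le> real (N div d)"
        using floor_divide_of_nat_eq[of N d, where 'a = real] by linarith+
      then have "\<bar>real (N div d) - real N / real d\<bar> / real N \<le> 1 / real N"
        by (intro divide_right_mono) auto
      moreover have "\<bar>real (N div d) - real N / real d\<bar> / real N = \<bar>real (N div d) / real N - 1 / real d\<bar>"
      proof -
        have "\<bar>real (N div d) - real N / real d\<bar> / real N = \<bar>(real (N div d) - real N / real d) / real N\<bar>"
          by (simp add: abs_divide)
        also have "(real (N div d) - real N / real d) / real N = real (N div d) / real N - 1 / real d"
          using ND by (simp add: diff_divide_distrib)
        finally show ?thesis .
      qed
      ultimately show "\<bar>c d * (real (N div d) / real N - 1 / real d)\<bar> \<le> 1 / real N"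
        using mult_mono[OF abs_le_1[of d]] by (fastforce simp: abs_mult)
    qed
    also have "\<dots> = real D / real N" by simp
    also note ND(1)
    finally have 1: "\<bar>\<Sum>d=1..D. c d * (real (N div d) / real N - 1 / real d)\<bar> < r / 3" .
    have "\<bar>\<Sum>d=Suc D..<Suc N. c d * real (N div d)\<bar> \<le> 2 * K * real (N div Suc D)"
      by (rule abel_antimono_bound) (use K ND in \<open>auto intro: div_le_mono2\<close>)
    also have "\<dots> \<le> 2 * K * (real N / real (Suc D))"
      using K by (intro mult_left_mono of_nat_div_le_of_nat) auto
    finally have "\<bar>\<Sum>d=Suc D..<Suc N. c d * real (N div d)\<bar> / real N
        \<le> 2 * K * (real N / real (Suc D)) / real N"
      by (rule divide_right_mono) simp
    also have "\<dots> = 2 * K / real (Suc D)" using ND by simp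
    also note D(1)
    finally have 2: "\<bar>(\<Sum>d=Suc D..<Suc N. c d * real (N div d)) / real N\<bar> < r / 3"
      by (simp add: abs_divide)
    show "norm ((\<Sum>n=1..N. dconv (\<lambda>_. 1) c n) / real N - L1) < r"
      using split 1 2 D(2) unfolding real_norm_def by linarith
  qed
qed

text \<open>At p^k the divisor sum is 1 + c(p) + ... + c(p)^k, which is k + 1, 1, or the indicator
  of even k, according as c(p) is 1, 0 or -1. Since \<open>square_ind\<close> is nonnegative, the
  inequalities at coprime arguments may be multiplied.\<close>

lemma divisor_sum_ge_square_ind: "n > 0 \<Longrightarrow> dconv (\<lambda>_. 1) c n \<ge> square_ind n"
proof (induction n rule: prime_power_coprime_induct)
  case one
  then show ?case using multiplicative_dconv[OF multiplicative_1 multiplicative] multiplicative_square_ind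
    by (simp add: multiplicative_def)
next
  case (prime_power p k)
  have "dconv (\<lambda>_. 1) c (p ^ k) = (\<Sum>i\<le>k. c p ^ i)"
    using prime_power by (simp add: dconv_prime_power power prime_gt_0_nat)
  moreover have "c p = -1 \<Longrightarrow> (\<Sum>i\<le>k. c p ^ i) = of_bool (even k)"
    by (induction k) auto
  moreover have "c p = 0 \<Longrightarrow> (\<Sum>i\<le>k. c p ^ i) = 1"
    by (induction k) auto
  ultimately show ?case
    using range[of p] prime_power by (auto simp: square_ind_prime_power)
next
  case (mult a b)
  then show ?case
    using mult_mono[OF mult.IH] square_ind_nonneg[of a] square_ind_nonneg[of b]
    by (simp add: multiplicativeD[OF multiplicative_dconv[OF multiplicative_1 multiplicative]]
        multiplicativeD[OF multiplicative_square_ind])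
qed

text \<open>The inequality of arithmetic and geometric means for the terms i and d - 1 - i. Writing
  the ratio as a square keeps the geometric mean s^(d - 1) free of roots.\<close>

lemma geometric_sum_ge:
  fixes s :: real
  shows "(\<Sum>i<d. (s\<^sup>2) ^ i) \<ge> real d * s ^ (d - 1)"
proof -
  have "2 * (real d * s ^ (d - 1)) = (\<Sum>i<d. 2 * s ^ (d - 1))" by simp
  also have "\<dots> \<le> (\<Sum>i<d. (s\<^sup>2) ^ i + (s\<^sup>2) ^ (d - Suc i))"
  proof (rule sum_mono)
    fix i assume "i \<in> {..<d}"
    then have "s ^ (d - 1) = s ^ i * s ^ (d - Suc i)" by (simp flip: power_add)
    then show "2 * s ^ (d - 1) \<le> (s\<^sup>2) ^ i + (s\<^sup>2) ^ (d - Suc i)"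
      using sum_squares_bound[of "s ^ i" "s ^ (d - Suc i)"]
      by (simp flip: power_mult add: mult.commute mult.left_commute)
  qed
  also have "\<dots> = 2 * (\<Sum>i<d. (s\<^sup>2) ^ i)"
    by (simp add: sum.distrib sum.nat_diff_reindex)
  finally show ?thesis by simp
qed

text \<open>Monsky's argument: if \<open>L1 = 0\<close> then the Lambert series
  \<open>\<Sum>d. c d * t ^ d / (1 - t ^ d)\<close> equals \<open>- (\<Sum>d. c d * \<beta> d)\<close> with \<open>\<beta>\<close> as below,
  hence stays bounded as \<open>t\<close> tends to 1; but its power series coefficients are at least those of
  \<open>\<Sum>j. t ^ j\<^sup>2\<close>.\<close>
lemma L1_nonzero: "L1 \<noteq> 0"
proof
  assume L0: "L1 = 0"
  obtain K where K: "K > 0" "\<And>n. \<bar>\<Sum>i<n. c i\<bar> \<le> K" using partial_sums_bounded by blast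
  have main: "(\<Sum>j=1..J. (s\<^sup>2) ^ (j\<^sup>2)) \<le> 2 * K" if s: "0 < s" "s < 1" for s :: real and J :: nat
  proof -
    define t where "t = s\<^sup>2"
    have t: "0 < t" "t < 1" using s by (auto simp: t_def power_less_one_iff)
    have tp: "t ^ d < 1" if "d > 0" for d using t that by (simp add: power_less_one_iff)
    define \<beta> where "\<beta> d = 1 / (real d * (1 - t)) - t ^ d / (1 - t ^ d)" for d
    define G where "G d = (\<Sum>i<d. t ^ i)" for d
    have G: "1 - t ^ d = (1 - t) * G d" for d
      unfolding G_def by (rule one_diff_power_eq)
    have Gpos: "G d > 0" if "d > 0" for d
      using G[of d] tp[OF that] t by (metis diff_gt_0_iff_gt zero_less_mult_pos)
    have \<beta>: "\<beta> d = (1 / real d - t ^ d / G d) / (1 - t)" if "d > 0" for d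
      unfolding \<beta>_def G diff_divide_distrib by (simp add: mult.commute)
    \<comment> \<open>Up to the factor 1 - t, the decrement of \<beta> is 1 / (d (d + 1)) - t^d /
      (G(d) G(d + 1)). Applying \<open>geometric_sum_ge\<close> at d and d + 1 bounds G(d) G(d + 1)
      below by d (d + 1) s^(2 d - 1), which is at least d (d + 1) t^d because s < 1.\<close>
    have dec: "\<beta> (Suc d) \<le> \<beta> d" if d: "d > 0" for d
    proof -
      have "(real d * s ^ (d - 1)) * (real (Suc d) * s ^ (Suc d - 1)) \<le> G d * G (Suc d)"
        unfolding G_def t_def by (intro mult_mono geometric_sum_ge) (use s in \<open>auto intro!: sum_nonneg\<close>)
      moreover have "s ^ (d - 1) * s ^ (Suc d - 1) \<ge> t ^ d"
        unfolding t_def power_mult[symmetric] power_add[symmetric]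
        by (rule power_decreasing) (use s in auto)
      ultimately have "real d * real (Suc d) * t ^ d \<le> G d * G (Suc d)"
        using mult_left_mono[of "t ^ d" "s ^ (d - 1) * s ^ (Suc d - 1)" "real d * real (Suc d)"]
        by (simp add: mult_ac)
      moreover have "x / A \<le> 1 / B" if "B * x \<le> A" "A > 0" "B > 0" for x A B :: real
        using that by (simp add: field_simps)
      ultimately have "t ^ d / (G d * G (Suc d)) \<le> 1 / (real d * real (Suc d))"
        using Gpos[OF d] Gpos[of "Suc d"] d by simp
      moreover have "1 / (real d * real (Suc d)) = 1 / real d - 1 / real (Suc d)"
        using d by (simp add: field_simps)
      moreover have "t ^ d / (G d * G (Suc d)) = t ^ d / G d - t ^ Suc d / G (Suc d)"
      proof -
        have "G (Suc d) - t * G d = 1"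
          by (simp only: G_def sum.lessThan_Suc_shift) (simp add: sum_distrib_left)
        then have "t ^ d * (G (Suc d) - t * G d) = t ^ d" by simp
        then show ?thesis using Gpos[OF d] Gpos[of "Suc d"] by (simp add: field_simps)
      qed
      ultimately have "1 / real (Suc d) - t ^ Suc d / G (Suc d) \<le> 1 / real d - t ^ d / G d" by simp
      then show ?thesis using t d by (simp only: \<beta> zero_less_Suc) (auto intro: divide_right_mono)
    qed
    have nonneg: "\<beta> d \<ge> 0" if d: "d > 0" for d
    proof -
      have "real d * t ^ d = (\<Sum>i<d. t ^ d)" by simp
      also have "\<dots> \<le> G d" unfolding G_def
        by (intro sum_mono power_decreasing) (use t in auto)
      finally show ?thesis using t Gpos[OF d] d by (simp add: \<beta> field_simps)
    qed
    \<comment> \<open>The initial value does not depend on t, which is why the bound from Abel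
      summation is uniform as t tends to 1.\<close>
    have "\<beta> 1 = 1" using t by (simp add: \<beta>_def field_simps)
    then have bound: "\<bar>\<Sum>d=1..M. c d * \<beta> d\<bar> \<le> 2 * K" for M
      using abel_antimono_bound[of c K 1 "Suc M" \<beta>, OF K(2)] dec nonneg
      by (simp add: atLeastLessThanSuc_atLeastAtMost)
    \<comment> \<open>Truncating at M cuts each geometric series after M div d terms. The remainder
      has exponent d (M div d + 1) >= M and denominator 1 - t^d >= 1 - t, so all remainders together
      are at most M t^M / (1 - t), which vanishes as M grows.\<close>
    have upper: "(\<Sum>n=1..M. dconv (\<lambda>_. 1) c n * t ^ n) \<le>
        (\<Sum>d=1..M. c d / real d) / (1 - t) + 2 * K + real M * t ^ M / (1 - t)" for M
    proof -
      have "(\<Sum>n=1..M. dconv (\<lambda>_. 1) c n * t ^ n) = (\<Sum>n=1..M. \<Sum>d | d dvd n. c d * t ^ (d * (n div d)))"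
        unfolding dconv_def by (simp add: sum_distrib_right)
      also have "\<dots> = (\<Sum>d=1..M. \<Sum>e=1..M div d. c d * t ^ (d * e))"
        by (rule sum_divisors_swap)
      also have "\<dots> = (\<Sum>d=1..M. (c d / real d) / (1 - t) - c d * \<beta> d
          - c d * t ^ (d * Suc (M div d)) / (1 - t ^ d))"
      proof (rule sum.cong)
        fix d assume d: "d \<in> {1..M}"
        have "(1 - t ^ d) * (\<Sum>e=1..M div d. (t ^ d) ^ e) = t ^ d - (t ^ d) ^ Suc (M div d)"
          using sum_gp_multiplied[of 1 "M div d" "t ^ d"] d by (simp add: Suc_le_eq div_greater_zero_iff)
        then have "(\<Sum>e=1..M div d. (t ^ d) ^ e) = (t ^ d - (t ^ d) ^ Suc (M div d)) / (1 - t ^ d)"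
          using tp[of d] d by (simp add: field_simps)
        then have "(\<Sum>e=1..M div d. c d * t ^ (d * e)) = c d * ((t ^ d - t ^ (d * Suc (M div d))) / (1 - t ^ d))"
          by (simp only: sum_distrib_left[symmetric] power_mult)
        also have "\<dots> = (c d / real d) / (1 - t) - c d * \<beta> d - c d * t ^ (d * Suc (M div d)) / (1 - t ^ d)"
          by (simp add: \<beta>_def right_diff_distrib diff_divide_distrib)
        finally show "(\<Sum>e=1..M div d. c d * t ^ (d * e)) = \<dots>" .
      qed simp
      also have "\<dots> = (\<Sum>d=1..M. c d / real d) / (1 - t) - (\<Sum>d=1..M. c d * \<beta> d)
          - (\<Sum>d=1..M. c d * t ^ (d * Suc (M div d)) / (1 - t ^ d))"
        by (simp add: sum_subtractf sum_divide_distrib)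
      finally have expand: "(\<Sum>n=1..M. dconv (\<lambda>_. 1) c n * t ^ n) = \<dots>" .
      have "- (\<Sum>d=1..M. c d * t ^ (d * Suc (M div d)) / (1 - t ^ d)) \<le> (\<Sum>d=1..M. t ^ M / (1 - t))"
        unfolding sum_negf[symmetric]
      proof (rule sum_mono)
        fix d assume d: "d \<in> {1..M}"
        have "- c d * t ^ (d * Suc (M div d)) / (1 - t ^ d) \<le> \<bar>c d * (t ^ (d * Suc (M div d)) / (1 - t ^ d))\<bar>"
          using abs_ge_minus_self[of "c d * (t ^ (d * Suc (M div d)) / (1 - t ^ d))"] by simp
        also have "\<dots> = \<bar>c d\<bar> * (t ^ (d * Suc (M div d)) / (1 - t ^ d))"
          using t tp[of d] d by (simp add: abs_mult)
        also have "\<dots> \<le> 1 * (t ^ M / (1 - t))"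
        proof (intro mult_mono frac_le abs_le_1)
          show "t ^ (d * Suc (M div d)) \<le> t ^ M"
          proof (rule power_decreasing)
            have "M mod d \<le> d" using d by (simp add: less_imp_le)
            then show "M \<le> d * Suc (M div d)"
              using mult_div_mod_eq[of d M] unfolding mult_Suc_right by linarith
          qed (use t in auto)
          show "1 - t \<le> 1 - t ^ d" using power_decreasing[of 1 d t] t d by simp
        qed (use t tp[of d] d in auto)
        finally show "- (c d * t ^ (d * Suc (M div d)) / (1 - t ^ d)) \<le> t ^ M / (1 - t)" by simp
      qed
      also have "\<dots> = real M * t ^ M / (1 - t)" by simp
      finally show ?thesis using bound[of M] unfolding expand by linarith
    qed
    have lower: "(\<Sum>j=1..J. t ^ (j\<^sup>2)) \<le> (\<Sum>n=1..M. dconv (\<lambda>_. 1) c n * t ^ n)" if M: "M \<ge> J\<^sup>2" for M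
    proof -
      have "(\<Sum>j=1..J. t ^ (j\<^sup>2)) = (\<Sum>n\<in>(\<lambda>j. j\<^sup>2) ` {1..J}. square_ind n * t ^ n)"
        by (subst sum.reindex) (auto simp: inj_on_def square_ind_def)
      also have "\<dots> \<le> (\<Sum>n=1..M. square_ind n * t ^ n)"
      proof (rule sum_mono2)
        show "(\<lambda>j. j\<^sup>2) ` {1..J} \<subseteq> {1..M}"
        proof clarify
          fix j assume "j \<in> {1..J}"
          then have "1 \<le> j\<^sup>2" "j\<^sup>2 \<le> J\<^sup>2" by (auto intro!: power_mono)
          then show "j\<^sup>2 \<in> {1..M}" using M order_trans[of "j\<^sup>2" "J\<^sup>2" M] by (simp only: atLeastAtMost_iff)
        qed
      qed (use t square_ind_nonneg in auto)
      also have "\<dots> \<le> (\<Sum>n=1..M. dconv (\<lambda>_. 1) c n * t ^ n)"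
        by (intro sum_mono mult_right_mono divisor_sum_ge_square_ind) (use t in auto)
      finally show ?thesis .
    qed
    have "(\<lambda>M. (\<Sum>d=1..M. c d / real d) / (1 - t) + 2 * K + real M * t ^ M / (1 - t))
        \<longlonglongrightarrow> L1 / (1 - t) + 2 * K + 0 / (1 - t)"
      using t by (intro tendsto_intros L1_partial_sums powser_times_n_limit_0) auto
    then have "(\<lambda>M. (\<Sum>d=1..M. c d / real d) / (1 - t) + 2 * K + real M * t ^ M / (1 - t))
        \<longlonglongrightarrow> 2 * K" using L0 by simp
    then show ?thesis unfolding t_def[symmetric]
    proof (rule tendsto_lowerbound)
      show "eventually (\<lambda>M. (\<Sum>j=1..J. t ^ (j\<^sup>2)) \<le>
          (\<Sum>d=1..M. c d / real d) / (1 - t) + 2 * K + real M * t ^ M / (1 - t)) sequentially"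
        using eventually_ge_at_top[of "J\<^sup>2"]
        by eventually_elim (use lower upper order_trans in blast)
    qed simp
  qed
  \<comment> \<open>For fixed J, letting s tend to 1 from the left turns each of the J terms into 1,
    while the bound 2 K stays.\<close>
  have "real J \<le> 2 * K" for J
  proof (rule tendsto_upperbound)
    have "((\<lambda>s::real. \<Sum>j=1..J. (s\<^sup>2) ^ (j\<^sup>2)) \<longlongrightarrow> (\<Sum>j=1..J. (1\<^sup>2) ^ (j\<^sup>2))) (at_left 1)"
      by (intro tendsto_intros)
    then show "((\<lambda>s::real. \<Sum>j=1..J. (s\<^sup>2) ^ (j\<^sup>2)) \<longlongrightarrow> real J) (at_left 1)" by simp
    show "eventually (\<lambda>s::real. (\<Sum>j=1..J. (s\<^sup>2) ^ (j\<^sup>2)) \<le> 2 * K) (at_left 1)"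
      by (rule eventually_mono[OF eventually_at_left_real[of 0 1]]) (use main in auto)
  qed simp
  then show False using reals_Archimedean2[of "2 * K"] by (meson not_le)
qed

end

section \<open>Square roots modulo prime powers\<close>

definition sqrt_residues :: "int \<Rightarrow> nat \<Rightarrow> int set" where
  "sqrt_residues q n = {r \<in> {0..<int n}. int n dvd r\<^sup>2 - q}"

lemma mod_mem_sqrt_residues:
  assumes "n > 0" "int n dvd r\<^sup>2 - q"
  shows "r mod int n \<in> sqrt_residues q n"
proof -
  have "[(r mod int n)\<^sup>2 - q = r\<^sup>2 - q] (mod int n)"
    by (intro cong_diff cong_pow cong_refl) (simp add: cong_def)
  then show ?thesis using assms by (simp add: sqrt_residues_def cong_dvd_iff)
qed

text \<open>By the Chinese remainder theorem, reduction modulo a and b identifies square roots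
  modulo a b with pairs of square roots.\<close>

lemma multiplicative_card_sqrt_residues: "multiplicative (\<lambda>n. real (card (sqrt_residues q n)))"
  unfolding multiplicative_def
proof (intro conjI allI impI)
  have "sqrt_residues q 1 = {0}" by (auto simp: sqrt_residues_def)
  then show "real (card (sqrt_residues q 1)) = 1" by simp
next
  fix a b :: nat assume ab: "a > 0" "b > 0" "coprime a b"
  have cop: "coprime (int a) (int b)" using ab by simp
  have "bij_betw (\<lambda>r. (r mod int a, r mod int b)) (sqrt_residues q (a * b))
      (sqrt_residues q a \<times> sqrt_residues q b)"
    unfolding bij_betw_def
  proof (intro conjI inj_onI subset_antisym subsetI)
    fix x y assume xy: "x \<in> sqrt_residues q (a * b)" "y \<in> sqrt_residues q (a * b)"
      "(x mod int a, x mod int b) = (y mod int a, y mod int b)"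
    then have "[x = y] (mod int a * int b)"
      by (intro coprime_cong_mult cop) (auto simp: cong_def)
    then show "x = y" using xy by (auto simp: sqrt_residues_def cong_def)
  next
    fix z assume "z \<in> (\<lambda>r. (r mod int a, r mod int b)) ` sqrt_residues q (a * b)"
    then show "z \<in> sqrt_residues q a \<times> sqrt_residues q b"
      using ab by (auto simp: sqrt_residues_def[of q "a * b"] intro!: mod_mem_sqrt_residues
          intro: dvd_trans[rotated])
  next
    fix z assume z: "z \<in> sqrt_residues q a \<times> sqrt_residues q b"
    then obtain u v where uv: "z = (u, v)" "u \<in> sqrt_residues q a" "v \<in> sqrt_residues q b" by auto
    obtain x where x: "[x = u] (mod int a)" "[x = v] (mod int b)"
      using binary_chinese_remainder_int[OF cop] by blast
    have "[x\<^sup>2 - q = u\<^sup>2 - q] (mod int a)" "[x\<^sup>2 - q = v\<^sup>2 - q] (mod int b)"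
      by (intro cong_diff cong_pow cong_refl x)+
    then have "int a dvd x\<^sup>2 - q" "int b dvd x\<^sup>2 - q"
      using uv by (auto simp: sqrt_residues_def cong_dvd_iff)
    then have "int (a * b) dvd x\<^sup>2 - q" using cop by (simp add: divides_mult)
    then have m: "x mod int (a * b) \<in> sqrt_residues q (a * b)"
      using ab by (intro mod_mem_sqrt_residues) auto
    have "x mod int (a * b) mod int a = u" "x mod int (a * b) mod int b = v"
      using x uv by (auto simp: mod_mod_cancel cong_def sqrt_residues_def)
    then show "z \<in> (\<lambda>r. (r mod int a, r mod int b)) ` sqrt_residues q (a * b)"
      using m uv(1) by (intro image_eqI[OF _ m]) auto
  qed
  then show "real (card (sqrt_residues q (a * b))) =
      real (card (sqrt_residues q a)) * real (card (sqrt_residues q b))"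
    using bij_betw_same_card by (fastforce simp: card_cartesian_product)
qed

text \<open>With r^2 - q = l^k u, the root r is replaced by r + t l^k, where t solves u + 2 r t = 0
  modulo l. This is possible because l is odd and, not dividing q, does not divide r; the quadratic
  term is divisible by l^(2 k).\<close>

lemma hensel_lift_sqrt:
  fixes l q :: int
  assumes l: "prime l" "odd l" "\<not> l dvd q" and r: "l dvd r\<^sup>2 - q"
  shows "k > 0 \<Longrightarrow> \<exists>r. l ^ k dvd r\<^sup>2 - q"
proof (induction k rule: nat_induct_non_zero)
  case 1
  then show ?case using r by auto
next
  case (Suc k)
  then obtain r u where u: "r\<^sup>2 - q = l ^ k * u" by (auto elim: dvdE)
  have "\<not> l dvd r"
  proof
    assume "l dvd r"
    moreover have "l dvd r\<^sup>2 - q" using u Suc.hyps by (simp add: dvd_power)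
    ultimately have "l dvd r\<^sup>2 - (r\<^sup>2 - q)"
      by (metis dvd_diff dvd_mult2 power2_eq_square)
    then show False using l by simp
  qed
  moreover have "\<not> l dvd 2"
  proof
    assume "l dvd 2"
    then have "l \<le> 2" by (rule zdvd_imp_le) simp
    then show False using l prime_ge_2_int[of l] by simp
  qed
  ultimately have "coprime (2 * r) l" using l
    by (metis coprime_commute prime_dvd_mult_eq_int prime_imp_coprime)
  then obtain v where v: "[2 * r * v = 1] (mod l)" using cong_solve_coprime_int by blast
  have "[u + 2 * r * v * (- u) = u + 1 * (- u)] (mod l)"
    by (intro cong_add cong_mult v cong_refl)
  then have "l dvd u + 2 * r * (v * (- u))" by (simp add: cong_0_iff mult.assoc)
  then obtain w where w: "u + 2 * r * (v * (- u)) = l * w" by (elim dvdE)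
  define t where "t = v * (- u)"
  have "(r + t * l ^ k)\<^sup>2 - q = (r\<^sup>2 - q) + l ^ k * (2 * r * t) + t\<^sup>2 * (l ^ k * l ^ k)"
    by (simp add: power2_eq_square algebra_simps)
  also have "\<dots> = l ^ k * (u + 2 * r * t) + t\<^sup>2 * (l ^ k * l ^ k)"
    by (simp add: u algebra_simps)
  also have "l ^ Suc k dvd \<dots>"
  proof (rule dvd_add)
    show "l ^ Suc k dvd l ^ k * (u + 2 * r * t)" using w by (simp add: t_def)
    have "l ^ Suc k dvd l ^ (k + k)" using Suc.hyps by (intro le_imp_power_dvd) simp
    then show "l ^ Suc k dvd t\<^sup>2 * (l ^ k * l ^ k)" by (simp only: power_add dvd_mult)
  qed
  finally show ?case by blast
qed

text \<open>If r and s are both roots, l^k divides (s - r) (s + r). The prime l cannot divide both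
  factors, as it would divide 2 r, so l^k divides one of them and the roots are exactly r and
  -r.\<close>

lemma sqrt_residues_odd_prime_power:
  fixes l :: nat
  assumes l: "prime l" "odd l" "\<not> int l dvd q" and k: "k > 0"
  shows "card (sqrt_residues q (l ^ k)) = (if QuadRes (int l) q then 2 else 0)"
proof -
  define n where "n = l ^ k"
  have npos: "int n > 0" using l by (simp add: n_def prime_gt_0_nat)
  have pl: "prime (int l)" using l by simp
  have ln: "int l dvd int n" using k by (simp add: n_def)
  have not_dvd: "\<not> int l dvd r" if "int n dvd r\<^sup>2 - q" for r
  proof
    assume "int l dvd r"
    moreover have "int l dvd r\<^sup>2 - q" using ln that by (rule dvd_trans)
    ultimately have "int l dvd r\<^sup>2 - (r\<^sup>2 - q)"
      by (metis dvd_diff dvd_mult2 power2_eq_square)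
    then show False using l by simp
  qed
  show ?thesis
  proof (cases "QuadRes (int l) q")
    case True
    then obtain y where "int l dvd y\<^sup>2 - q" by (auto simp: QuadRes_def cong_iff_dvd_diff)
    then obtain r where r: "int n dvd r\<^sup>2 - q"
      using hensel_lift_sqrt[OF pl _ l(3) _ k] l(2) by (auto simp: n_def)
    have "int n dvd s\<^sup>2 - q \<longleftrightarrow> [s = r] (mod int n) \<or> [s = - r] (mod int n)" for s
    proof
      assume s: "int n dvd s\<^sup>2 - q"
      have "int n dvd (s\<^sup>2 - q) - (r\<^sup>2 - q)" using r s by (rule dvd_diff[rotated])
      then have d: "int l ^ k dvd (s - r) * (s + r)"
        by (simp add: n_def power2_eq_square algebra_simps)
      have "\<not> (int l dvd s - r \<and> int l dvd s + r)"
      proof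
        assume "int l dvd s - r \<and> int l dvd s + r"
        then have "int l dvd (s + r) - (s - r)" by (metis dvd_diff)
        then have "int l dvd 2 * r" by simp
        then have "int l dvd 2" using pl not_dvd[OF r] by (simp add: prime_dvd_mult_iff)
        then have "int l \<le> 2" by (rule zdvd_imp_le) simp
        then show False using l prime_ge_2_nat[of l] by simp
      qed
      then have "coprime (int l ^ k) (s - r) \<or> coprime (int l ^ k) (s + r)"
        using pl by (auto simp: prime_imp_coprime)
      then show "[s = r] (mod int n) \<or> [s = - r] (mod int n)"
        using d by (auto simp: n_def cong_iff_dvd_diff coprime_dvd_mult_left_iff coprime_dvd_mult_right_iff)
    next
      assume "[s = r] (mod int n) \<or> [s = - r] (mod int n)"
      then have "[s\<^sup>2 - q = r\<^sup>2 - q] (mod int n)"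
        by (metis cong_diff cong_pow cong_refl power2_minus)
      then show "int n dvd s\<^sup>2 - q" using r by (simp add: cong_dvd_iff)
    qed
    note key = this
    have "sqrt_residues q n = {r mod int n, (- r) mod int n}"
    proof (intro subset_antisym subsetI)
      fix s assume "s \<in> sqrt_residues q n"
      then have "s mod int n = s" "[s = r] (mod int n) \<or> [s = - r] (mod int n)"
        using key[of s] by (auto simp: sqrt_residues_def)
      then show "s \<in> {r mod int n, (- r) mod int n}" unfolding cong_def by auto
    next
      fix s assume "s \<in> {r mod int n, (- r) mod int n}"
      then show "s \<in> sqrt_residues q n"
        using npos r by (auto intro!: mod_mem_sqrt_residues)
    qed
    moreover have "r mod int n \<noteq> (- r) mod int n"
    proof
      assume "r mod int n = (- r) mod int n"
      then have "int n dvd r - (- r)" by (simp add: mod_eq_dvd_iff)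
      then have "int l dvd 2 * r" using ln dvd_trans by fastforce
      then have "int l dvd 2" using pl not_dvd[OF r] by (simp add: prime_dvd_mult_iff)
      then have "int l \<le> 2" by (rule zdvd_imp_le) simp
      then show False using l prime_ge_2_nat[of l] by simp
    qed
    ultimately show ?thesis using True by (simp add: n_def)
  next
    case False
    have "\<not> int n dvd r\<^sup>2 - q" for r
      using False dvd_trans[OF ln] unfolding QuadRes_def cong_iff_dvd_diff by blast
    then have "sqrt_residues q n = {}" by (simp add: sqrt_residues_def)
    then show ?thesis using False by (simp add: n_def)
  qed
qed

text \<open>A root is divisible by l. For k >= 2 this would make l^2 divide q, whose absolute value
  is l.\<close>

lemma sqrt_residues_ramified:
  fixes l :: nat
  assumes l: "prime l" "\<bar>q\<bar> = int l" and k: "k > 0"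
  shows "card (sqrt_residues q (l ^ k)) = (if k = 1 then 1 else 0)"
proof -
  have pl: "prime (int l)" using l by simp
  have lq: "int l dvd q" using l(2) by (metis dvd_abs_iff dvd_refl)
  have r: "int l dvd r" if "int l dvd r\<^sup>2 - q" for r
  proof -
    have "int l dvd (r\<^sup>2 - q) + q" using that lq by (rule dvd_add)
    then show ?thesis using prime_dvd_power_int[OF pl] by simp
  qed
  show ?thesis
  proof (cases "k = 1")
    case True
    have "sqrt_residues q l = {0}"
    proof (intro subset_antisym subsetI)
      fix x assume "x \<in> sqrt_residues q l"
      then have x: "int l dvd x" "0 \<le> x" "x < int l"
        using r[of x] by (simp_all add: sqrt_residues_def)
      then have "\<not> 0 < x" using zdvd_not_zless by blast
      then show "x \<in> {0}" using x(2) by simp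
    next
      fix x :: int assume "x \<in> {0}"
      then show "x \<in> sqrt_residues q l"
        using lq prime_gt_0_nat[OF l(1)] by (simp add: sqrt_residues_def)
    qed
    then show ?thesis using True by simp
  next
    case False
    have "\<not> int (l ^ k) dvd x\<^sup>2 - q" for x
    proof
      assume "int (l ^ k) dvd x\<^sup>2 - q"
      moreover have "int l ^ 2 dvd int (l ^ k)" using False k by (simp add: le_imp_power_dvd)
      ultimately have d: "int l ^ 2 dvd x\<^sup>2 - q" by (rule dvd_trans[rotated])
      then have "int l dvd x\<^sup>2 - q" by (rule dvd_trans[rotated]) (simp add: power2_eq_square)
      then have "int l ^ 2 dvd x\<^sup>2" by (rule dvd_power_same[OF r])
      from this d have "int l ^ 2 dvd x\<^sup>2 - (x\<^sup>2 - q)" by (rule dvd_diff)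
      then have "int l ^ 2 dvd \<bar>q\<bar>" by simp
      then have "int l ^ 2 dvd int l" unfolding l(2) .
      then have "int l ^ 2 \<le> int l" by (rule zdvd_imp_le) (use l in \<open>simp add: prime_gt_0_nat\<close>)
      then show False using prime_gt_1_nat[OF l(1)] by (simp add: power2_eq_square)
    qed
    then have "sqrt_residues q (l ^ k) = {}" by (simp add: sqrt_residues_def)
    then show ?thesis using False by simp
  qed
qed

lemma sqrt_residues_2:
  assumes "odd q"
  shows "card (sqrt_residues q 2) = 1"
proof -
  have "sqrt_residues q 2 = {1}"
  proof (intro subset_antisym subsetI)
    fix x assume "x \<in> sqrt_residues q 2"
    then have "x = 0 \<or> x = 1" "even (x\<^sup>2 - q)" by (auto simp: sqrt_residues_def)
    then show "x \<in> {1}" using assms by auto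
  qed (use assms in \<open>auto simp: sqrt_residues_def\<close>)
  then show ?thesis by simp
qed

lemma sqrt_residues_4:
  assumes "q mod 4 = 1"
  shows "card (sqrt_residues q 4) = 2"
proof -
  have "sqrt_residues q 4 = {1, 3}"
  proof (intro subset_antisym subsetI)
    fix x assume "x \<in> sqrt_residues q 4"
    then have "x = 0 \<or> x = 1 \<or> x = 2 \<or> x = 3" "4 dvd x\<^sup>2 - q" by (auto simp: sqrt_residues_def)
    then show "x \<in> {1, 3}" using assms by (elim disjE) (simp_all, presburger+)
  next
    fix x :: int assume "x \<in> {1, 3}"
    moreover have "4 dvd 1 - q" "4 dvd 9 - q" using assms by presburger+
    ultimately show "x \<in> sqrt_residues q 4" by (auto simp: sqrt_residues_def)
  qed
  then show ?thesis by simp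
qed

lemma odd_square_mod_8: "odd (r :: int) \<Longrightarrow> 8 dvd r\<^sup>2 - 1"
proof -
  assume "odd r"
  then obtain j where "r = 2 * j + 1" by (elim oddE)
  then have eq: "r\<^sup>2 - 1 = 4 * (j * (j + 1))" by (simp add: power2_eq_square algebra_simps)
  have "4 * 2 dvd 4 * (j * (j + 1))" by (intro mult_dvd_mono) auto
  then show ?thesis by (simp add: eq)
qed

lemma sqrt_residues_empty_mod_4:
  assumes "q mod 4 = 3" "k \<ge> 2"
  shows "sqrt_residues q (2 ^ k) = {}"
proof -
  have "\<not> int (2 ^ k) dvd r\<^sup>2 - q" for r
  proof
    assume "int (2 ^ k) dvd r\<^sup>2 - q"
    moreover have "(4::int) dvd int (2 ^ k)" using le_imp_power_dvd[OF assms(2), of "2::int"] by simp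
    ultimately have d: "4 dvd r\<^sup>2 - q" by (rule dvd_trans[rotated])
    show False
    proof (cases "even r")
      case True
      then have "4 dvd r\<^sup>2" by (auto elim!: evenE simp: power2_eq_square)
      then show False using d assms by presburger
    next
      case False
      then have "8 dvd r\<^sup>2 - 1" by (rule odd_square_mod_8)
      then show False using d assms by presburger
    qed
  qed
  then show ?thesis by (simp add: sqrt_residues_def)
qed

lemma sqrt_residues_empty_mod_8:
  assumes "q mod 8 = 5" "k \<ge> 3"
  shows "sqrt_residues q (2 ^ k) = {}"
proof -
  have "\<not> int (2 ^ k) dvd r\<^sup>2 - q" for r
  proof
    assume "int (2 ^ k) dvd r\<^sup>2 - q"
    moreover have "(8::int) dvd int (2 ^ k)" using le_imp_power_dvd[OF assms(2), of "2::int"] by simp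
    ultimately have d: "8 dvd r\<^sup>2 - q" by (rule dvd_trans[rotated])
    then have "even (r\<^sup>2 - q)" by presburger
    then have "odd r" using assms by simp presburger
    then have "8 dvd r\<^sup>2 - 1" by (rule odd_square_mod_8)
    then show False using d assms by presburger
  qed
  then show ?thesis by (simp add: sqrt_residues_def)
qed

text \<open>The derivative 2 r is even, so the correction is 2^(k - 1) instead of a multiple of 2^k.
  It changes the square by 2^k r + 2^(2 k - 2); here r is odd and 2 k - 2 >= k + 1 for k >= 3, so an
  odd quotient u becomes even.\<close>

lemma hensel_lift_sqrt_2:
  assumes "q mod 8 = 1"
  shows "k \<ge> 3 \<Longrightarrow> \<exists>r::int. 2 ^ k dvd r\<^sup>2 - q"
proof (induction k rule: dec_induct)
  case base
  have "(8::int) dvd 1 - q" using assms by presburger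
  then show ?case by (intro exI[of _ 1]) simp
next
  case (step k)
  then obtain r u where u: "r\<^sup>2 - q = 2 ^ k * u" by (auto elim: dvdE)
  have "even (r\<^sup>2 - q)" using u step.hyps by simp
  then have r: "odd r" using assms by simp presburger
  obtain i where i: "k = i + 3" using step.hyps by (metis add.commute le_Suc_ex)
  show ?case
  proof (cases "even u")
    case True
    then show ?thesis using u by (intro exI[of _ r]) (auto elim!: evenE)
  next
    case False
    have "(r + 2 ^ (i + 2))\<^sup>2 - q = (r\<^sup>2 - q) + 2 ^ k * r + 2 ^ k * 2 ^ (i + 1)"
      by (simp add: i power2_eq_square power_add algebra_simps)
    also have "\<dots> = 2 ^ k * (u + r + 2 ^ (i + 1))" by (simp add: u algebra_simps)
    also have "2 ^ Suc k dvd \<dots>"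
    proof -
      have "even (u + r + 2 ^ (i + 1))" using False r by simp
      then show ?thesis by (auto elim!: evenE)
    qed
    finally show ?thesis by blast
  qed
qed

text \<open>Being a root modulo 2^k depends only on the class modulo h = 2^(k - 1). There the roots
  are r and -r, distinct because r is odd and 4 divides h, and each class has two representatives
  modulo 2^k.\<close>

lemma sqrt_residues_2_power:
  assumes "q mod 8 = 1" "k \<ge> 3"
  shows "card (sqrt_residues q (2 ^ k)) = 4"
proof -
  obtain r :: int where r: "2 ^ k dvd r\<^sup>2 - q" using hensel_lift_sqrt_2 assms by blast
  obtain i where i: "k = i + 3" using assms(2) by (metis add.commute le_Suc_ex)
  define h :: int where "h = 4 * 2 ^ i"
  have h: "2 ^ k = 2 * h" "h > 0" "4 dvd h" "2 * h dvd h * h"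
    by (auto simp: h_def i power_add)
  have "2 dvd (2::int) ^ k" using i by simp
  then have "even (r\<^sup>2 - q)" using r by (rule dvd_trans)
  then have oddr: "odd r" using assms by simp presburger
  have key: "2 * h dvd s\<^sup>2 - q \<longleftrightarrow> s mod h = r mod h \<or> s mod h = (- r) mod h" for s
  proof
    assume s: "2 * h dvd s\<^sup>2 - q"
    then have "even (s\<^sup>2 - q)" by (rule dvd_trans[rotated]) simp
    then have odds: "odd s" using assms by simp presburger
    have "2 * h dvd (s\<^sup>2 - q) - (r\<^sup>2 - q)" using r s unfolding h(1) by (rule dvd_diff[rotated])
    then have d: "2 * h dvd (s - r) * (s + r)" by (simp add: power2_eq_square algebra_simps)
    \<comment> \<open>Both s - r and s + r are even. Their halves differ by the odd number r, so one
      half is odd and the other takes the whole factor 2^(k - 2) of the product.\<close>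
    obtain x y where xy: "s - r = 2 * x" "s + r = 2 * y" using odds oddr
      by (metis even_add even_diff evenE)
    have "odd x \<or> odd y"
    proof (rule ccontr)
      assume "\<not> (odd x \<or> odd y)"
      then have "4 dvd 2 * y - 2 * x" by (auto elim!: evenE)
      moreover have "2 * y - 2 * x = 2 * r" using xy by linarith
      ultimately have "4 dvd 2 * r" by simp
      then show False using oddr by presburger
    qed
    obtain z where "2 * x * (2 * y) = 2 * h * z" using d unfolding xy by (elim dvdE)
    then have "x * y = 2 * 2 ^ i * z" by (simp add: h_def)
    then have d': "2 * 2 ^ i dvd x * y" by simp
    have "2 ^ Suc i dvd x \<or> 2 ^ Suc i dvd y"
    proof (cases "odd x")
      case True
      then have "coprime (2 ^ Suc i) x" by simp
      then show ?thesis using d' by (simp add: coprime_dvd_mult_right_iff)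
    next
      case False
      then have "coprime (2 ^ Suc i) y" using \<open>odd x \<or> odd y\<close> by simp
      then show ?thesis using d' by (simp add: coprime_dvd_mult_left_iff)
    qed
    then have "h dvd s - r \<or> h dvd s - (- r)" using xy by (auto simp: h_def elim!: dvdE)
    then show "s mod h = r mod h \<or> s mod h = (- r) mod h" by (simp add: mod_eq_dvd_iff)
  next
    have *: "2 * h dvd s\<^sup>2 - q" if st: "s mod h = t mod h" and tq: "2 * h dvd t\<^sup>2 - q" for t
    proof -
      obtain j where "s - t = h * j" using st unfolding mod_eq_dvd_iff by (elim dvdE)
      then have s: "s = t + h * j" by simp
      have "s\<^sup>2 - q = (t\<^sup>2 - q) + 2 * h * (t * j) + h * h * (j * j)"
        by (simp add: s power2_eq_square algebra_simps)
      also have "2 * h dvd \<dots>" using tq h(4) by (intro dvd_add) auto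
      finally show ?thesis .
    qed
    show "2 * h dvd s\<^sup>2 - q" if "s mod h = r mod h \<or> s mod h = (- r) mod h"
      using that *[of r] *[of "- r"] r h by auto
  qed
  define r0 r1 where "r0 = r mod h" and "r1 = (- r) mod h"
  have r01: "0 \<le> r0" "r0 < h" "0 \<le> r1" "r1 < h" using h by (auto simp: r0_def r1_def)
  have "r0 \<noteq> r1"
  proof
    assume "r0 = r1"
    then have "h dvd r - (- r)" by (simp add: r0_def r1_def mod_eq_dvd_iff)
    then have "4 dvd 2 * r" using h(3) by (simp add: dvd_trans)
    then show False using oddr by presburger
  qed
  have "sqrt_residues q (2 ^ k) = {r0, r1, r0 + h, r1 + h}"
  proof (intro subset_antisym subsetI)
    fix s assume "s \<in> sqrt_residues q (2 ^ k)"
    then have s: "0 \<le> s" "s < 2 * h" "s mod h = r0 \<or> s mod h = r1"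
      using h key by (auto simp: sqrt_residues_def r0_def r1_def)
    have "s = s mod h \<or> s = s mod h + h"
    proof (cases "s < h")
      case False
      then have "s mod h = (s - h) mod h" by (simp add: mod_diff_right_eq)
      also have "\<dots> = s - h" using False s by (intro mod_pos_pos_trivial) auto
      finally show ?thesis by simp
    qed (use s in simp)
    then show "s \<in> {r0, r1, r0 + h, r1 + h}" using s(3) by auto
  next
    fix s assume "s \<in> {r0, r1, r0 + h, r1 + h}"
    then have "s mod h = r0 \<or> s mod h = r1" "0 \<le> s" "s < 2 * h"
      using r01 by auto
    then show "s \<in> sqrt_residues q (2 ^ k)"
      using h key[of s] by (auto simp: sqrt_residues_def r0_def r1_def)
  qed
  then show ?thesis using r01 \<open>r0 \<noteq> r1\<close> by simp
qed

section \<open>The Kronecker symbol as a periodic character\<close>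

lemma Legendre_range: "Legendre a p \<in> {-1, 0, 1}"
  by (simp add: Legendre_def)

lemma Legendre_cong:
  assumes "[a = b] (mod p)"
  shows "Legendre a p = Legendre b p"
proof -
  have "[x = a] (mod p) \<longleftrightarrow> [x = b] (mod p)" for x
    using assms cong_sym cong_trans by blast
  moreover have "[a = 0] (mod p) \<longleftrightarrow> [b = 0] (mod p)"
    using assms cong_sym cong_trans by blast
  ultimately show ?thesis by (simp add: Legendre_def QuadRes_def)
qed

text \<open>Elements of {-1, 0, 1} differ by at most 2, which is less than p. This turns congruences
  from Euler's criterion into equalities.\<close>

lemma sign_eqI:
  fixes x y :: int
  assumes "[x = y] (mod int p)" "p > 2" "x \<in> {-1, 0, 1}" "y \<in> {-1, 0, 1}"
  shows "x = y"
proof (rule ccontr)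
  assume "x \<noteq> y"
  have "int p dvd x - y" using assms(1) by (simp add: cong_iff_dvd_diff)
  then have "int p \<le> \<bar>x - y\<bar>" using \<open>x \<noteq> y\<close> by (intro zdvd_imp_le) auto
  then show False using assms(2-4) by auto
qed

lemma Legendre_mult:
  fixes p :: nat
  assumes "prime p" "p > 2"
  shows "Legendre (a * b) p = Legendre a p * Legendre b p"
proof (rule sign_eqI[OF _ assms(2) Legendre_range])
  have "[Legendre (a * b) p = a ^ ((p - 1) div 2) * b ^ ((p - 1) div 2)] (mod int p)"
    using euler_criterion[OF assms, of "a * b"] by (simp add: power_mult_distrib)
  moreover have "[Legendre a p * Legendre b p = a ^ ((p - 1) div 2) * b ^ ((p - 1) div 2)] (mod int p)"
    by (intro cong_mult euler_criterion assms)
  ultimately show "[Legendre (a * b) p = Legendre a p * Legendre b p] (mod int p)"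
    using cong_sym cong_trans by blast
  show "Legendre a p * Legendre b p \<in> {-1, 0, 1}"
    using Legendre_range[of a p] Legendre_range[of b p] by auto
qed

lemma Legendre_4_mult:
  fixes l :: nat
  assumes l: "prime l" "l > 2"
  shows "Legendre (4 * q) l = Legendre q l"
proof -
  have "\<not> l dvd 2" using l(2) by (auto dest: dvd_imp_le)
  then have "\<not> int l dvd 2" using int_dvd_int_iff[of l 2] by simp
  then have "Legendre 2 (int l) \<noteq> 0" by (simp add: Legendre_def cong_0_iff)
  then have L4: "Legendre 2 (int l) * Legendre 2 (int l) = 1"
    using Legendre_range[of 2 "int l"] by auto
  have "Legendre (4 * q) l = Legendre (2 * 2 * q) l" by simp
  also have "\<dots> = Legendre q (int l)" unfolding Legendre_mult[OF l] L4 by simp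
  finally show ?thesis .
qed

lemma Legendre_1: "p > 1 \<Longrightarrow> Legendre 1 p = 1"
  by (auto simp: Legendre_def QuadRes_def cong_def intro!: exI[of _ 1])

lemma Legendre_eq_0_iff: "Legendre a p = 0 \<longleftrightarrow> p dvd a"
  by (simp add: Legendre_def cong_0_iff)

text \<open>Extends the sign (-1)^((p - 1) / 2), which occurs both in the law for -1 and in
  reciprocity, to a multiplicative function on all natural numbers.\<close>

definition chi4 :: "nat \<Rightarrow> int" where
  "chi4 n = (if even n then 0 else if n mod 4 = 1 then 1 else -1)"

lemma chi4_mult: "chi4 (a * b) = chi4 a * chi4 b"
proof -
  have "a mod 4 = 0 \<or> a mod 4 = 1 \<or> a mod 4 = 2 \<or> a mod 4 = 3"
    "b mod 4 = 0 \<or> b mod 4 = 1 \<or> b mod 4 = 2 \<or> b mod 4 = 3" by presburger+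
  moreover have "(a * b) mod 4 = (a mod 4) * (b mod 4) mod 4" by (simp add: mod_mult_eq)
  moreover have "even n \<longleftrightarrow> n mod 4 = 0 \<or> n mod 4 = 2" for n :: nat by presburger
  ultimately show ?thesis unfolding chi4_def by (elim disjE) simp_all
qed

lemma chi4_add_twice_odd: "odd p \<Longrightarrow> chi4 (n + 2 * p) = - chi4 n"
  unfolding chi4_def by (simp; presburger)

lemma chi4_eq_power: "odd p \<Longrightarrow> chi4 p = (-1) ^ ((p - 1) div 2)"
proof -
  assume "odd p"
  then have "p mod 4 = 1 \<longleftrightarrow> even ((p - 1) div 2)" by presburger
  then show ?thesis using \<open>odd p\<close> by (simp add: chi4_def)
qed

lemma Legendre_minus_1:
  fixes p :: nat
  assumes "prime p" "p > 2"
  shows "Legendre (-1) p = chi4 p"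
proof (rule sign_eqI[OF _ assms(2) Legendre_range])
  have "odd p" using assms prime_odd_nat by blast
  then show "[Legendre (-1) p = chi4 p] (mod int p)"
    using euler_criterion[OF assms, of "-1"] by (simp add: chi4_eq_power)
qed (simp add: chi4_def)

text \<open>The sign is written as a character in \<open>l\<close> for fixed \<open>p\<close>, ready
  for comparing functions of \<open>l\<close>. The case of equal primes is included, both symbols
  then being 0.\<close>

lemma Legendre_reciprocity:
  fixes p l :: nat
  assumes "prime p" "p > 2" "prime l" "l > 2"
  shows "Legendre p l = (if p mod 4 = 3 then chi4 l else 1) * Legendre l p"
proof (cases "p = l")
  case True
  then show ?thesis by (simp add: Legendre_def cong_def)
next
  case False
  have odd: "odd p" "odd l" using assms prime_odd_nat by blast+
  have "\<not> l dvd p" "\<not> p dvd l" using assms False primes_dvd_imp_eq by blast+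
  then have "Legendre p l \<noteq> 0" "Legendre l p \<noteq> 0" by (simp_all add: Legendre_eq_0_iff)
  then have pm: "Legendre p l \<in> {-1, 1}" "Legendre l p \<in> {-1, 1}"
    using Legendre_range[of p l] Legendre_range[of l p] by auto
  have "Legendre p l * Legendre l p = (-1) ^ ((p - 1) div 2 * ((l - 1) div 2))"
    by (rule Quadratic_Reciprocity) (use assms False in auto)
  also have "\<dots> = ((-1) ^ ((l - 1) div 2)) ^ ((p - 1) div 2)"
    by (simp add: mult.commute flip: power_mult)
  also have "\<dots> = chi4 l ^ ((p - 1) div 2)" using odd by (simp add: chi4_eq_power)
  also have "\<dots> = (if p mod 4 = 3 then chi4 l else 1)"
  proof -
    have "odd ((p - 1) div 2) \<longleftrightarrow> p mod 4 = 3" using odd by presburger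
    moreover have "chi4 l = 1 \<or> chi4 l = -1" using odd by (simp add: chi4_def)
    ultimately show ?thesis by auto
  qed
  finally have "Legendre p l * Legendre l p * Legendre l p = \<dots> * Legendre l p" by simp
  then show ?thesis using pm(2) by auto
qed

lemma uminus_mod_4_eq:
  fixes x :: int
  shows "(- x) mod 4 = 1 \<longleftrightarrow> x mod 4 = 3" "(- x) mod 4 = 3 \<longleftrightarrow> x mod 4 = 1"
  by presburger+

lemma int_mod_8_iff: "int p mod 8 = 1 \<or> int p mod 8 = 7 \<longleftrightarrow> p mod 8 = 1 \<or> p mod 8 = 7"
proof -
  have "int p mod 8 = int (p mod 8)" by (simp add: zmod_int)
  then show ?thesis by auto
qed

text \<open>Gauss's lemma with multiplier 2. With h = (p - 1) / 2, the products 2, 4, ..., 2 h are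
  already reduced modulo p, and those above h come from the x > h div 2. Their number h - h div 2
  has a parity determined by p modulo 8.\<close>

lemma Legendre_2:
  fixes p :: nat
  assumes "prime p" "p > 2"
  shows "Legendre 2 p = (if p mod 8 = 1 \<or> p mod 8 = 7 then 1 else -1)"
proof -
  have odd: "odd p" using assms prime_odd_nat by blast
  interpret GAUSS p 2
    using assms by unfold_locales (auto simp: cong_0_iff dest: zdvd_imp_le)
  define h where "h = (int p - 1) div 2"
  have p: "int p = 2 * h + 1" unfolding h_def using odd by presburger
  have "C = (\<lambda>x. 2 * x) ` {0<..h}"
    unfolding C_def B_def A_def image_image h_def[symmetric]
    by (intro image_cong refl) (use p in auto)
  then have "E = (\<lambda>x. 2 * x) ` {h div 2<..h}"
    unfolding E_def h_def[symmetric] using p assms by (auto simp: image_iff)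
  then have "card E = nat (h - h div 2)" by (simp add: card_image inj_on_def)
  moreover have "even (nat (h - h div 2)) \<longleftrightarrow> p mod 8 = 1 \<or> p mod 8 = 7"
  proof -
    have "h \<ge> 0" using p assms by linarith
    then have "even (nat (h - h div 2)) \<longleftrightarrow> even (h - h div 2)" by (simp add: even_nat_iff)
    also have "\<dots> \<longleftrightarrow> int p mod 8 = 1 \<or> int p mod 8 = 7" unfolding p by presburger
    also have "\<dots> \<longleftrightarrow> p mod 8 = 1 \<or> p mod 8 = 7" by (rule int_mod_8_iff)
    finally show ?thesis .
  qed
  ultimately show ?thesis using gauss_lemma by simp
qed

text \<open>Squaring identifies 1 and p - 1, so by the pigeonhole principle it misses a nonzero
  residue.\<close>

lemma ex_quadratic_nonresidue:
  fixes p :: nat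
  assumes "prime p" "p > 2"
  obtains g where "Legendre (int g) p = -1"
proof -
  define f where "f x = x\<^sup>2 mod p" for x :: nat
  have ran: "f ` {1..<p} \<subseteq> {1..<p}"
  proof clarify
    fix x assume x: "x \<in> {1..<p}"
    then have "\<not> p dvd x" by (auto dest: dvd_imp_le)
    then have "\<not> p dvd x\<^sup>2" using assms prime_dvd_power by blast
    then show "f x \<in> {1..<p}" using assms by (auto simp: f_def Suc_le_eq dvd_eq_mod_eq_0)
  qed
  have "(p - 1)\<^sup>2 = 1 + p * (p - 2)"
    using assms(2) by (auto simp: power2_eq_square algebra_simps dest!: less_imp_Suc_add)
  then have "f (p - 1) = (1 + p * (p - 2)) mod p" by (simp only: f_def)
  also have "\<dots> = f 1" unfolding mod_mult_self2 by (simp add: f_def)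
  finally have "f (p - 1) = f 1" .
  moreover have "1 \<in> {1..<p}" "p - 1 \<in> {1..<p}" "p - 1 \<noteq> 1" using assms by auto
  ultimately have "\<not> inj_on f {1..<p}" by (metis inj_on_def)
  then have "f ` {1..<p} \<noteq> {1..<p}" by (metis eq_card_imp_inj_on finite_atLeastLessThan)
  then obtain g where g: "g \<in> {1..<p}" "g \<notin> f ` {1..<p}" using ran by blast
  have "\<not> QuadRes p (int g)"
  proof
    assume "QuadRes p (int g)"
    then obtain y where y: "[y\<^sup>2 = int g] (mod int p)" by (auto simp: QuadRes_def)
    define x where "x = nat (y mod int p)"
    have x: "int x = y mod int p" using assms by (simp add: x_def)
    have "int (f x) = (y mod int p)\<^sup>2 mod int p" by (simp add: f_def zmod_int x)
    also have "\<dots> = y\<^sup>2 mod int p" by (simp add: power_mod)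
    also have "\<dots> = int g" using y g by (simp add: cong_def)
    finally have "f x = g" by simp
    moreover have "x < p" using assms by (simp add: x_def nat_less_iff)
    moreover have "x \<noteq> 0" using \<open>f x = g\<close> g by (auto simp: f_def)
    ultimately show False using g by auto
  qed
  moreover have "\<not> int p dvd int g" using g by (auto dest: dvd_imp_le)
  ultimately have "Legendre (int g) p = -1" by (simp add: Legendre_def cong_0_iff)
  then show ?thesis by (rule that)
qed

text \<open>Multiplication by a nonresidue permutes the residues and changes the sign of every
  symbol, so the sum equals its own negative.\<close>

lemma sum_Legendre:
  fixes p :: nat
  assumes "prime p" "p > 2"
  shows "(\<Sum>n<p. Legendre (int n) p) = 0"
proof -
  obtain g where g: "Legendre (int g) p = -1" using ex_quadratic_nonresidue[OF assms] .
  have "\<not> p dvd g" using g Legendre_eq_0_iff[of "int g" p] by auto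
  then have cop: "coprime g p" using assms by (metis coprime_commute prime_imp_coprime)
  have "inj_on (\<lambda>n. g * n mod p) {..<p}"
  proof (rule inj_onI)
    fix x y assume xy: "x \<in> {..<p}" "y \<in> {..<p}" "g * x mod p = g * y mod p"
    then have "[x = y] (mod p)" using cop by (simp add: cong_def[symmetric] cong_mult_lcancel_nat)
    then show "x = y" using xy by (simp add: cong_def)
  qed
  moreover have "(\<lambda>n. g * n mod p) ` {..<p} \<subseteq> {..<p}" using assms by auto
  ultimately have bij: "bij_betw (\<lambda>n. g * n mod p) {..<p} {..<p}"
    by (simp add: bij_betw_def endo_inj_surj)
  have "(\<Sum>n<p. Legendre (int n) p) = (\<Sum>n<p. Legendre (int (g * n mod p)) p)"
    using sum.reindex_bij_betw[OF bij, of "\<lambda>n. Legendre (int n) p"] by simp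
  also have "\<dots> = (\<Sum>n<p. Legendre (int g) p * Legendre (int n) p)"
    by (intro sum.cong refl)
      (simp add: Legendre_mult[OF assms, symmetric] zmod_int Legendre_cong[of "_ mod int p"] cong_def)
  also have "\<dots> = - (\<Sum>n<p. Legendre (int n) p)" by (simp add: g sum_negf)
  finally show ?thesis by simp
qed

lemma completely_multiplicative_eqI:
  fixes f g :: "nat \<Rightarrow> int"
  assumes "f 1 = 1" "g 1 = 1"
    and "\<And>a b. a > 0 \<Longrightarrow> b > 0 \<Longrightarrow> f (a * b) = f a * f b"
    and "\<And>a b. a > 0 \<Longrightarrow> b > 0 \<Longrightarrow> g (a * b) = g a * g b"
    and "\<And>p. prime p \<Longrightarrow> f p = g p" and "n > 0"
  shows "f n = g n"
  using \<open>n > 0\<close>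
proof (induction n rule: prime_power_coprime_induct)
  case (prime_power p k)
  have "f (p ^ k) = g (p ^ k)" for k
    by (induction k) (use assms prime_power in \<open>auto simp: prime_gt_0_nat\<close>)
  then show ?case .
qed (use assms in auto)

section \<open>Periodicity of the Kronecker symbol in its lower argument\<close>

lemma kronecker_0_right: "\<bar>d\<bar> \<noteq> 1 \<Longrightarrow> kronecker d 0 = 0"
  by (simp add: kronecker_def)

lemma kronecker_1_right: "kronecker d 1 = 1"
  by (simp add: kronecker_def)

lemma kronecker_mult_right:
  assumes "a > 0" "b > 0"
  shows "kronecker d (a * b) = kronecker d a * kronecker d b"
  using assms by (simp add: kronecker_def prime_factorization_mult mult_less_0_iff not_less less_imp_le)

lemma kronecker_prime_right: "prime p \<Longrightarrow> kronecker d (int p) = kronecker_prime d (int p)"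
  by (simp add: kronecker_def prime_factorization_prime)

text \<open>Both sides are completely multiplicative in n, so it suffices to compare them at primes.
  At 2 the condition on q modulo 8 is insensitive to the sign of q. At an odd prime reciprocity
  applies: for positive q it carries no sign, and for q = -p, where p is 3 modulo 4, its sign
  \<open>chi4 l\<close> cancels the one from the symbol of -1.\<close>

lemma kronecker_eq_Legendre:
  fixes q :: int
  assumes q: "prime \<bar>q\<bar>" "q mod 4 = 1"
  shows "kronecker q (int n) = Legendre (int n) \<bar>q\<bar>"
proof -
  define p where "p = nat \<bar>q\<bar>"
  have pq: "int p = \<bar>q\<bar>" by (simp add: p_def)
  have p: "prime p" using q(1) by (simp add: p_def)
  have "odd (int p)" unfolding pq using q(2) by (simp; presburger)
  then have "p \<noteq> 2" by auto
  then have p2: "p > 2" using prime_ge_2_nat[OF p] by simp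
  show ?thesis
  proof (cases "n = 0")
    case True
    then show ?thesis using q p2 pq by (auto simp: kronecker_def Legendre_def)
  next
    case False
    have "kronecker q (int n) = Legendre (int n) (int p)"
    proof (rule completely_multiplicative_eqI[where f = "\<lambda>n. kronecker q (int n)"
          and g = "\<lambda>n. Legendre (int n) (int p)"])
      fix l :: nat assume l: "prime l"
      show "kronecker q (int l) = Legendre (int l) (int p)"
      proof (cases "l = 2")
        case True
        have "odd q" using q(2) by presburger
        moreover have "q mod 8 = 1 \<or> q mod 8 = 7 \<longleftrightarrow> p mod 8 = 1 \<or> p mod 8 = 7"
        proof -
          have "int p mod 8 = 1 \<or> int p mod 8 = 7 \<longleftrightarrow> q mod 8 = 1 \<or> q mod 8 = 7"
            unfolding pq by (cases "q \<ge> 0"; simp; presburger)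
          then show ?thesis unfolding int_mod_8_iff by simp
        qed
        ultimately show ?thesis
          using True l Legendre_2[OF p p2] by (simp add: kronecker_prime_right[of 2, simplified] kronecker_prime_def)
      next
        case False
        then have l2: "l > 2" using prime_ge_2_nat[OF l] by simp
        have "kronecker q (int l) = Legendre q (int l)"
          using False l by (simp add: kronecker_prime_right kronecker_prime_def)
        also have "\<dots> = Legendre (int l) (int p)"
        proof (cases "q > 0")
          case True
          then have "q = int p" using pq by simp
          then have "int (p mod 4) = 1" using q(2) by (simp add: zmod_int)
          then have "p mod 4 \<noteq> 3" by simp
          then show ?thesis using True pq Legendre_reciprocity[OF p p2 l l2] by simp
        next
          case False
          then have "q = - int p" using pq by simp
          then have "q = -1 * int p" "int (p mod 4) = 3"
            using q(2) by (simp_all add: zmod_int uminus_mod_4_eq)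
          then have "q = -1 * int p" "p mod 4 = 3" by simp_all
          moreover have "chi4 l * chi4 l = 1"
            using prime_odd_nat[OF l l2] by (simp add: chi4_def)
          ultimately show ?thesis
            using Legendre_reciprocity[OF p p2 l l2] Legendre_mult[OF l l2, of "-1" "int p"]
              Legendre_minus_1[OF l l2] by simp
        qed
        finally show ?thesis .
      qed
    qed (use False p p2 in \<open>auto simp: kronecker_mult_right Legendre_mult kronecker_1_right[simplified] Legendre_1\<close>)
    then show ?thesis by (simp add: pq)
  qed
qed

lemma real_character_kronecker_1:
  fixes q :: int
  assumes q: "prime \<bar>q\<bar>" "q mod 4 = 1"
  shows "real_character (\<lambda>n. real_of_int (kronecker q (int n))) (nat \<bar>q\<bar>)"
proof -
  define p where "p = nat \<bar>q\<bar>"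
  have pq: "int p = \<bar>q\<bar>" by (simp add: p_def)
  have p: "prime p" using q(1) by (simp add: p_def)
  have "odd (int p)" unfolding pq using q(2) by (simp; presburger)
  then have "p \<noteq> 2" by auto
  then have p2: "p > 2" using prime_ge_2_nat[OF p] by simp
  have *: "real_of_int (kronecker q (int n)) = real_of_int (Legendre (int n) p)" for n
    using kronecker_eq_Legendre[OF q] pq by simp
  show ?thesis unfolding * p_def[symmetric]
  proof
    show "real_of_int (Legendre (int (n + p)) p) = real_of_int (Legendre (int n) p)" for n
      by (simp add: Legendre_cong[of "int n + int p" "int n"] cong_def)
    show "(\<Sum>n<p. real_of_int (Legendre (int n) p)) = 0"
      using sum_Legendre[OF p p2] by (simp flip: of_int_sum)
    show "real_of_int (Legendre (int n) p) \<in> {-1, 0, 1}" for n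
      using Legendre_range[of "int n" p] by auto
  qed (use p p2 in \<open>auto simp: Legendre_mult Legendre_1 prime_gt_0_nat\<close>)
qed

text \<open>At odd primes the factor \<open>chi4\<close> comes from reciprocity if q = p with p
  congruent to 3 modulo 4, and from the symbol of -1 if q = -p with p congruent to 1; for q = -1
  nothing else is left. At 2 both sides vanish.\<close>

lemma kronecker_4_eq:
  fixes q :: int
  assumes q: "prime \<bar>q\<bar> \<or> q = -1" "q mod 4 = 3"
  shows "kronecker (4 * q) (int n) = chi4 n * (if q = -1 then 1 else Legendre (int n) \<bar>q\<bar>)"
proof (cases "n = 0")
  case True
  moreover have "\<bar>4 * q\<bar> \<noteq> 1" by presburger
  ultimately show ?thesis by (simp add: kronecker_0_right chi4_def)
next
  case False
  define p where "p = nat \<bar>q\<bar>"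
  have pq: "int p = \<bar>q\<bar>" by (simp add: p_def)
  have p: "prime p \<and> p > 2" if "q \<noteq> -1"
  proof -
    have "prime p" using q(1) that by (simp add: p_def)
    have "odd (int p)" unfolding pq using q(2) by (simp; presburger)
    then have "p \<noteq> 2" by auto
    then show ?thesis using prime_ge_2_nat[of p] \<open>prime p\<close> by simp
  qed
  define \<psi> where "\<psi> n = chi4 n * (if q = -1 then 1 else Legendre (int n) (int p))" for n
  have "kronecker (4 * q) (int n) = \<psi> n"
  proof (rule completely_multiplicative_eqI[where f = "\<lambda>n. kronecker (4 * q) (int n)" and g = \<psi>])
    fix l :: nat assume l: "prime l"
    show "kronecker (4 * q) (int l) = \<psi> l"
    proof (cases "l = 2")
      case True
      then show ?thesis using l
        by (simp add: kronecker_prime_right[of 2, simplified] kronecker_prime_def \<psi>_def chi4_def)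
    next
      case False
      then have l2: "l > 2" using prime_ge_2_nat[OF l] by simp
      have "kronecker (4 * q) (int l) = Legendre q (int l)"
        using False l by (simp add: kronecker_prime_right kronecker_prime_def Legendre_4_mult[OF l l2])
      also have "\<dots> = \<psi> l"
      proof (cases "q = -1")
        case True
        then show ?thesis using Legendre_minus_1[OF l l2] by (simp add: \<psi>_def)
      next
        case q1: False
        then have p': "prime p" "p > 2" using p by auto
        show ?thesis
        proof (cases "q > 0")
          case True
          then have "q = int p" using pq by simp
          then have "int (p mod 4) = 3" using q(2) by (simp add: zmod_int)
          then have "p mod 4 = 3" by simp
          then show ?thesis using True q1 pq Legendre_reciprocity[OF p' l l2] by (simp add: \<psi>_def)
        next
          case False
          then have "q = - int p" using pq by simp
          then have "q = -1 * int p" "int (p mod 4) = 1"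
            using q(2) by (simp_all add: zmod_int uminus_mod_4_eq)
          then have "q = -1 * int p" "p mod 4 \<noteq> 3" by simp_all
          then show ?thesis
            using Legendre_reciprocity[OF p' l l2] Legendre_mult[OF l l2, of "-1" "int p"]
              Legendre_minus_1[OF l l2] q1 by (simp add: \<psi>_def)
        qed
      qed
      finally show ?thesis .
    qed
  qed (use False p in \<open>auto simp: kronecker_mult_right Legendre_mult kronecker_1_right[simplified] Legendre_1
      chi4_mult \<psi>_def\<close>, simp_all add: chi4_def)
  then show ?thesis by (simp add: pq \<psi>_def)
qed

text \<open>A shift by 2 |q| keeps the Legendre factor and reverses the sign of \<open>chi4\<close>,
  so the two halves of a period cancel.\<close>

lemma real_character_kronecker_3:
  fixes q :: int
  assumes q: "prime \<bar>q\<bar> \<or> q = -1" "q mod 4 = 3"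
  shows "real_character (\<lambda>n. real_of_int (kronecker (4 * q) (int n))) (4 * nat \<bar>q\<bar>)"
proof -
  define p where "p = nat \<bar>q\<bar>"
  have pq: "int p = \<bar>q\<bar>" by (simp add: p_def)
  have "odd (int p)" unfolding pq using q(2) by (simp; presburger)
  then have odd: "odd p" by simp
  have p: "prime p \<and> p > 2" if "q \<noteq> -1"
  proof -
    have "prime p" using q(1) that by (simp add: p_def)
    moreover have "p \<noteq> 2" using odd by auto
    ultimately show ?thesis using prime_ge_2_nat[of p] by simp
  qed
  define \<psi> where "\<psi> n = chi4 n * (if q = -1 then 1 else Legendre (int n) (int p))" for n
  have *: "real_of_int (kronecker (4 * q) (int n)) = real_of_int (\<psi> n)" for n
    using kronecker_4_eq[OF q] pq by (simp add: \<psi>_def)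
  have anti: "\<psi> (n + 2 * p) = - \<psi> n" for n
  proof -
    have "Legendre (int (n + 2 * p)) p = Legendre (int n) p"
      by (rule Legendre_cong) (simp add: cong_def)
    then show ?thesis unfolding \<psi>_def chi4_add_twice_odd[OF odd] by simp
  qed
  show ?thesis unfolding * p_def[symmetric]
  proof
    show "4 * p > 0" using odd by (cases p) auto
    show "real_of_int (\<psi> (n + 4 * p)) = real_of_int (\<psi> n)" for n
      using anti[of "n + 2 * p"] anti[of n] by (simp add: add.assoc)
    have "(\<Sum>n<2 * p + k. \<psi> n) = (\<Sum>n<2 * p. \<psi> n) + (\<Sum>n<k. \<psi> (n + 2 * p))" for k
      by (induction k) (simp_all add: add_ac)
    from this[of "2 * p"] have "(\<Sum>n<4 * p. \<psi> n) = 0" by (simp add: anti sum_negf)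
    then show "(\<Sum>n<4 * p. real_of_int (\<psi> n)) = 0"
      by (simp flip: of_int_sum)
    show "real_of_int (\<psi> n) \<in> {-1, 0, 1}" for n
      using Legendre_range[of "int n" p] by (auto simp: \<psi>_def chi4_def)
    show "real_of_int (\<psi> 1) = 1" using p by (auto simp: \<psi>_def chi4_def Legendre_1)
    show "real_of_int (\<psi> (a * b)) = real_of_int (\<psi> a) * real_of_int (\<psi> b)" for a b
      using p by (auto simp: \<psi>_def chi4_mult Legendre_mult)
  qed
qed

section \<open>Counting pairs\<close>

text \<open>The coefficients of the Dirichlet polynomial 1 + u 2^-s + v 4^-s, by which the Euler
  factor at 2 is multiplied.\<close>

definition factor_at_2 :: "real \<Rightarrow> real \<Rightarrow> nat \<Rightarrow> real" where
  "factor_at_2 u v n = (if n = 1 then 1 else if n = 2 then u else if n = 4 then v else 0)"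

lemma multiplicative_factor_at_2: "multiplicative (factor_at_2 u v)"
  unfolding multiplicative_def
proof (intro conjI allI impI)
  fix a b :: nat assume ab: "a > 0" "b > 0" "coprime a b"
  show "factor_at_2 u v (a * b) = factor_at_2 u v a * factor_at_2 u v b"
  proof (cases "a = 1 \<or> b = 1")
    case True
    then show ?thesis by (auto simp: factor_at_2_def)
  next
    case False
    have even: "even n" if "factor_at_2 u v n \<noteq> 0" "n \<noteq> 1" for n
      using that by (auto simp: factor_at_2_def split: if_splits)
    have "odd a \<or> odd b" using ab(3) by (auto dest: coprime_common_divisor_nat)
    then have "factor_at_2 u v a * factor_at_2 u v b = 0" using even False by auto
    moreover have "a * b \<noteq> 2 \<and> a * b \<noteq> 4"
    proof -
      have "a \<ge> 2" "b \<ge> 2" using ab False by auto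
      moreover have "a \<noteq> b" using ab(3) False by auto
      ultimately have "a \<ge> 3 \<and> b \<ge> 2 \<or> a \<ge> 2 \<and> b \<ge> 3" by linarith
      then have "a * b \<ge> 6" using mult_le_mono[of 3 a 2 b] mult_le_mono[of 2 a 3 b] by auto
      then show ?thesis by simp
    qed
    ultimately show ?thesis using False by (auto simp: factor_at_2_def)
  qed
qed (simp add: factor_at_2_def)

lemma factor_at_2_power: "factor_at_2 u v (2 ^ i) = (if i = 0 then 1 else if i = 1 then u else if i = 2 then v else 0)"
proof -
  have "(2::nat) ^ i = 1 \<longleftrightarrow> i = 0" "(2::nat) ^ i = 2 \<longleftrightarrow> i = 1" "(2::nat) ^ i = 4 \<longleftrightarrow> i = 2"
    using power_inject_exp[of "2::nat" i 0] power_inject_exp[of "2::nat" i 1]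
      power_inject_exp[of "2::nat" i 2] by simp_all
  then show ?thesis by (simp add: factor_at_2_def)
qed

lemma factor_at_2_odd_power:
  assumes "odd p"
  shows "factor_at_2 u v (p ^ i) = (if p ^ i = 1 then 1 else 0)"
proof -
  have "odd (p ^ i)" using assms by simp
  then have "p ^ i \<noteq> 2" "p ^ i \<noteq> 4" by (metis even_numeral)+
  then show ?thesis by (simp add: factor_at_2_def)
qed

lemma factor_at_2_sums: "(\<lambda>n. factor_at_2 u v n / real n) sums (1 + u / 2 + v / 4)"
proof -
  have "(\<lambda>n. factor_at_2 u v n / real n) sums (\<Sum>n\<in>{1, 2, 4}. factor_at_2 u v n / real n)"
    by (rule sums_finite) (auto simp: factor_at_2_def)
  then show ?thesis by (simp add: factor_at_2_def add.assoc)
qed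

lemma summable_abs_factor_at_2: "summable (\<lambda>n. \<bar>factor_at_2 u v n\<bar> / real n)"
  by (rule summable_finite[of "{1, 2, 4}"]) (auto simp: factor_at_2_def)

section \<open>The mean number of square roots\<close>

context real_character begin

definition reduced_divisor_sum :: "nat \<Rightarrow> real" where
  "reduced_divisor_sum = dconv (dconv (\<lambda>_. 1) c) moebius_sqrt"

lemma multiplicative_reduced_divisor_sum: "multiplicative reduced_divisor_sum"
  unfolding reduced_divisor_sum_def
  by (intro multiplicative_dconv multiplicative_1 multiplicative multiplicative_moebius_sqrt)

text \<open>The Euler factor (1 - x^2) / ((1 - x) (1 - c x)) simplifies to (1 + x) / (1 - c x), with
  c the value of the character at \<open>p\<close>. For k > 0 the coefficients are 2, 2, 2, ... if c
  = 1, then 1, 0, 0, ... if c = 0, and all 0 if c = -1: the root counts in the split, ramified and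
  inert cases.\<close>

lemma reduced_divisor_sum_prime_power:
  assumes "prime p"
  shows "reduced_divisor_sum (p ^ k) = (if k = 0 then 1 else c p ^ k + c p ^ (k - 1))"
proof -
  define S where "S j = (\<Sum>i\<le>j. c p ^ i)" for j
  have S: "dconv (\<lambda>_. 1) c (p ^ j) = S j" for j
    using assms by (simp add: dconv_prime_power S_def power prime_gt_0_nat)
  have "reduced_divisor_sum (p ^ k) = S k - (if k \<ge> 2 then S (k - 2) else 0)"
    unfolding reduced_divisor_sum_def dconv_prime_power[OF assms, of _ moebius_sqrt] S
      moebius_sqrt_prime_power[OF assms]
    by (subst sum_conv_short_support) auto
  also have "\<dots> = (if k = 0 then 1 else c p ^ k + c p ^ (k - 1))"
  proof -
    consider "k = 0" | "k = 1" | j where "k = Suc (Suc j)" by (metis not0_implies_Suc One_nat_def)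
    then show ?thesis by cases (auto simp: S_def)
  qed
  finally show ?thesis .
qed

text \<open>The Dirichlet series of \<open>card (sqrt_residues q n)\<close> is
  \<open>\<zeta>(s) L(s, c) / \<zeta>(2 s)\<close> up to the Euler factor at 2, corrected by \<open>1 + u 2\<^sup>-\<^sup>s + v 4\<^sup>-\<^sup>s\<close>.\<close>
lemma mean_value_card_sqrt_residues:
  assumes q: "prime \<bar>q\<bar> \<or> q = -1"
    and odd: "\<And>l. prime l \<Longrightarrow> l > 2 \<Longrightarrow> c l = Legendre q (int l)"
    and two: "\<And>k. k > 0 \<Longrightarrow> real (card (sqrt_residues q (2 ^ k))) =
      reduced_divisor_sum (2 ^ k) + u * reduced_divisor_sum (2 ^ (k - 1))
        + (if k \<ge> 2 then v * reduced_divisor_sum (2 ^ (k - 2)) else 0)"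
  shows "mean_value (\<lambda>n. real (card (sqrt_residues q n))) (L1 * (6 / pi\<^sup>2) * (1 + u / 2 + v / 4))"
proof -
  have "mean_value (dconv reduced_divisor_sum (factor_at_2 u v))
      (L1 * (\<Sum>n. moebius_sqrt n / real n) * (\<Sum>n. factor_at_2 u v n / real n))"
    unfolding reduced_divisor_sum_def
    by (intro mean_value_dconv mean_value_divisor_sum summable_moebius_sqrt summable_abs_factor_at_2)
  then have "mean_value (dconv reduced_divisor_sum (factor_at_2 u v))
      (L1 * (6 / pi\<^sup>2) * (1 + u / 2 + v / 4))"
    by (simp only: suminf_moebius_sqrt sums_unique[OF factor_at_2_sums, symmetric])
  moreover have "real (card (sqrt_residues q n)) = dconv reduced_divisor_sum (factor_at_2 u v) n"
    if "n > 0" for n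
  proof (rule multiplicative_eqI[OF multiplicative_card_sqrt_residues _ that])
    show "multiplicative (dconv reduced_divisor_sum (factor_at_2 u v))"
      by (intro multiplicative_dconv multiplicative_reduced_divisor_sum multiplicative_factor_at_2)
    fix l k :: nat assume l: "prime l" and k: "k > 0"
    show "real (card (sqrt_residues q (l ^ k))) = dconv reduced_divisor_sum (factor_at_2 u v) (l ^ k)"
    proof (cases "l = 2")
      case True
      have "dconv reduced_divisor_sum (factor_at_2 u v) (2 ^ k) =
        reduced_divisor_sum (2 ^ k) + u * reduced_divisor_sum (2 ^ (k - 1))
        + (if k \<ge> 2 then v * reduced_divisor_sum (2 ^ (k - 2)) else 0)"
        unfolding dconv_prime_power[OF two_is_prime_nat] factor_at_2_power
        using k by (subst sum_conv_short_support) auto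
      then show ?thesis using two[OF k] True by simp
    next
      case False
      then have l2: "l > 2" using prime_ge_2_nat[OF l] by simp
      then have oddl: "odd l" using l prime_odd_nat by blast
      have "dconv reduced_divisor_sum (factor_at_2 u v) (l ^ k) =
          (\<Sum>i\<le>k. if i = 0 then reduced_divisor_sum (l ^ k) else 0)"
        unfolding dconv_prime_power[OF l] factor_at_2_odd_power[OF oddl]
        using l2 by (intro sum.cong) auto
      also have "\<dots> = c l ^ k + c l ^ (k - 1)"
        using reduced_divisor_sum_prime_power[OF l] k by simp
      also have "\<dots> = real (card (sqrt_residues q (l ^ k)))"
      proof (cases "int l dvd q")
        case True
        have "q \<noteq> -1" using True l2 by auto
        then have "\<bar>q\<bar> = int l"
          using q l True primes_dvd_imp_eq[of "int l" "\<bar>q\<bar>"] by simp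
        moreover have "c l = 0" using True odd[OF l l2] by (simp add: Legendre_eq_0_iff)
        ultimately show ?thesis using sqrt_residues_ramified[OF l _ k] k
          by (cases "k = 1") (auto simp: power_0_left)
      next
        case nd: False
        then have "c l = (if QuadRes (int l) q then 1 else -1)"
          using odd[OF l l2] by (simp add: Legendre_def cong_0_iff)
        moreover obtain j where "k = Suc j" using k gr0_implies_Suc by blast
        ultimately show ?thesis using sqrt_residues_odd_prime_power[OF l oddl nd k] by simp
      qed
      finally show ?thesis by simp
    qed
  qed
  ultimately show ?thesis by (subst mean_value_cong) auto
qed

end

section \<open>From square roots modulo b to pairs\<close>

text \<open>A root r with r^2 = q would correspond to the partner a = 0, which is not
  positive.\<close>

lemma not_square_of_prime:
  fixes q :: int
  assumes "prime \<bar>q\<bar> \<or> q = -1"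
  shows "r\<^sup>2 \<noteq> q"
proof
  assume r: "r\<^sup>2 = q"
  then have "q \<ge> 0" by auto
  then have q: "prime q" using assms by auto
  then have "q dvd r" using r prime_dvd_power_int[of q r 2] by simp
  then obtain s where "r = q * s" by (elim dvdE)
  then have "q * (q * s\<^sup>2) = q * 1" using r by (simp add: power2_eq_square mult_ac)
  then have "q dvd 1" using q by (metis dvd_triv_left mult_left_cancel not_prime_0)
  then show False using q not_prime_unit by blast
qed

lemma card_partners:
  fixes q :: int and b :: nat
  assumes q: "prime \<bar>q\<bar> \<or> q = -1" and b: "int b > 2 * \<bar>q\<bar> + 2"
  shows "card {a \<in> {1..<b}. is_square (int a * int b + q)} = card (sqrt_residues q b)"
proof -
  define f where "f r = nat ((r\<^sup>2 - q) div int b)" for r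
  have bpos: "int b > 0" using b by linarith
  have f: "f r \<in> {1..<b} \<and> int (f r) * int b = r\<^sup>2 - q" if r: "r \<in> sqrt_residues q b" for r
  proof -
    have r': "0 \<le> r" "r \<le> int b - 1" "int b dvd r\<^sup>2 - q" using r by (auto simp: sqrt_residues_def)
    \<comment> \<open>Otherwise b would divide q - r^2, which is positive because q is not a square,
      yet at most |q| and hence less than b.\<close>
    have "r\<^sup>2 - q > 0"
    proof (rule ccontr)
      assume "\<not> r\<^sup>2 - q > 0"
      then have "0 < q - r\<^sup>2" using not_square_of_prime[OF q, of r] by simp
      moreover have "int b dvd q - r\<^sup>2" using r'(3) by (simp add: dvd_diff_commute)
      ultimately have "int b \<le> q - r\<^sup>2" by (rule zdvd_imp_le[rotated])
      moreover have "r\<^sup>2 \<ge> 0" by simp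
      ultimately show False using b by linarith
    qed
    obtain a where a: "r\<^sup>2 - q = int b * a" using r'(3) by (elim dvdE)
    have "a > 0" using a \<open>r\<^sup>2 - q > 0\<close> bpos by (simp add: zero_less_mult_iff)
    have "r\<^sup>2 \<le> (int b - 1)\<^sup>2" using r' by (intro power_mono)
    \<comment> \<open>Since (b - 1)^2 = b^2 - (2 b - 1) and 2 b - 1 > |q|, the quotient a stays
      below b.\<close>
    then have "r\<^sup>2 - q < int b * int b" using b by (simp add: power2_eq_square algebra_simps)
    then have "a < int b" using a bpos by simp
    moreover have "f r = nat a" using a bpos by (simp add: f_def)
    ultimately show ?thesis using \<open>a > 0\<close> a by auto
  qed
  have "bij_betw f (sqrt_residues q b) {a \<in> {1..<b}. is_square (int a * int b + q)}"
    unfolding bij_betw_def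
  proof (intro conjI inj_onI subset_antisym subsetI)
    fix x y assume xy: "x \<in> sqrt_residues q b" "y \<in> sqrt_residues q b" "f x = f y"
    then have "x\<^sup>2 = y\<^sup>2" using f[OF xy(1)] f[OF xy(2)] by simp
    then show "x = y" using xy by (auto simp: sqrt_residues_def power2_eq_iff_nonneg)
  next
    fix a assume "a \<in> f ` sqrt_residues q b"
    then obtain r where r: "a = f r" "r \<in> sqrt_residues q b" by auto
    then have "int a * int b + q = r\<^sup>2" using f by simp
    then show "a \<in> {a \<in> {1..<b}. is_square (int a * int b + q)}"
      using f[OF r(2)] r(1) by simp
  next
    fix a assume a: "a \<in> {a \<in> {1..<b}. is_square (int a * int b + q)}"
    then obtain r' where r': "int a * int b + q = r'\<^sup>2" by (auto simp: is_nth_power_def)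
    define r where "r = \<bar>r'\<bar>"
    have r: "int a * int b + q = r\<^sup>2" "r \<ge> 0" using r' by (auto simp: r_def)
    have "int a * int b \<le> (int b - 1) * int b" using a by (intro mult_right_mono) auto
    then have "r\<^sup>2 < (int b)\<^sup>2" using r(1) b by (simp add: power2_eq_square algebra_simps)
    then have "r < int b" by (rule power_less_imp_less_base) simp
    moreover have eq: "r\<^sup>2 - q = int b * int a" using r(1) by (simp add: algebra_simps)
    ultimately have "r \<in> sqrt_residues q b" using r(2) by (simp add: sqrt_residues_def)
    moreover have "f r = a" using eq bpos by (simp add: f_def)
    ultimately show "a \<in> f ` sqrt_residues q b" by blast
  qed
  then show ?thesis by (metis bij_betw_same_card)
qed

lemma D2_Suc: "D2 q (Suc N) = D2 q N + card {a \<in> {1..<Suc N}. is_square (int a * int (Suc N) + q)}"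
proof -
  let ?A = "{a \<in> {1..<Suc N}. is_square (int a * int (Suc N) + q)}"
  let ?D = "\<lambda>N. {P. D_pair q P \<and> P \<subseteq> {1..N}}"
  have "?D (Suc N) = ?D N \<union> (\<lambda>a. {a, Suc N}) ` ?A"
  proof (intro subset_antisym subsetI)
    fix P assume P: "P \<in> ?D (Suc N)"
    then obtain a b where ab: "P = {a, b}" "a \<noteq> b" "0 < a" "0 < b" "is_square (int a * int b + q)"
      by (auto simp: D_pair_def)
    show "P \<in> ?D N \<union> (\<lambda>a. {a, Suc N}) ` ?A"
    proof (cases "P \<subseteq> {1..N}")
      case False
      then consider "a = Suc N" | "b = Suc N" using P ab by (auto simp: le_Suc_eq)
      then show ?thesis
      proof cases
        case 1
        then have "b \<in> ?A" "P = {b, Suc N}" using P ab by (auto simp: mult.commute)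
        then show ?thesis by blast
      next
        case 2
        then have "a \<in> ?A" "P = {a, Suc N}" using P ab by auto
        then show ?thesis by blast
      qed
    qed (use P in blast)
  next
    fix P assume "P \<in> ?D N \<union> (\<lambda>a. {a, Suc N}) ` ?A"
    then show "P \<in> ?D (Suc N)"
    proof
      assume "P \<in> (\<lambda>a. {a, Suc N}) ` ?A"
      then obtain a where a: "P = {a, Suc N}" "a \<in> ?A" by blast
      then have "D_pair q P" unfolding D_pair_def by (intro exI[of _ a] exI[of _ "Suc N"]) auto
      then show ?thesis using a by auto
    qed auto
  qed
  moreover have "finite (?D N)" by (rule finite_subset[of _ "Pow {1..N}"]) auto
  moreover have "?D N \<inter> (\<lambda>a. {a, Suc N}) ` ?A = {}" by auto
  moreover have "inj_on (\<lambda>a. {a, Suc N}) ?A"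
    by (auto simp: inj_on_def doubleton_eq_iff)
  ultimately show ?thesis unfolding D2_def by (simp add: card_Un_disjoint card_image)
qed

lemma D2_over_N_tendsto:
  assumes q: "prime \<bar>q\<bar> \<or> q = -1"
    and mean: "mean_value (\<lambda>n. real (card (sqrt_residues q n))) L"
  shows "(\<lambda>N. real (D2 q N) / real N) \<longlonglongrightarrow> L"
proof -
  define R where "R N = (\<Sum>n=1..N. real (card (sqrt_residues q n)))" for N
  define B where "B = nat (2 * \<bar>q\<bar> + 2)"
  \<comment> \<open>From B on, both counts grow by the same amount. The step from N to N + 1
    concerns b = N + 1, for which N >= B gives the strict bound of
    \<open>card_partners\<close>.\<close>
  have eq: "real (D2 q N) - R N = real (D2 q B) - R B" if "N \<ge> B" for N
    using that
  proof (induction N rule: dec_induct)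
    case (step N)
    have "card {a \<in> {1..<Suc N}. is_square (int a * int (Suc N) + q)} = card (sqrt_residues q (Suc N))"
      by (rule card_partners[OF q]) (use step.hyps in \<open>simp add: B_def\<close>)
    then have "D2 q (Suc N) = D2 q N + card (sqrt_residues q (Suc N))" unfolding D2_Suc by simp
    then show ?case using step.IH by (simp add: R_def)
  qed simp
  have "(\<lambda>N. R N / real N + (real (D2 q B) - R B) / real N) \<longlonglongrightarrow> L + 0"
    using mean unfolding mean_value_def R_def by (intro tendsto_add lim_const_over_n)
  moreover have "eventually (\<lambda>N. R N / real N + (real (D2 q B) - R B) / real N = real (D2 q N) / real N) sequentially"
    using eventually_ge_at_top[of B]
  proof eventually_elim
    case (elim N)
    have "real (D2 q N) = R N + (real (D2 q B) - R B)" using eq[OF elim] by simp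
    then show ?case by (simp add: add_divide_distrib)
  qed
  ultimately show ?thesis by (simp add: tendsto_cong)
qed

lemma (in real_character) D2_asymp_equiv:
  assumes q: "prime \<bar>q\<bar> \<or> q = -1"
    and mean: "mean_value (\<lambda>n. real (card (sqrt_residues q n))) (L1 * (6 / pi\<^sup>2) * w)"
    and "w \<noteq> 0" and chi: "\<And>n. chi n = of_real (c n)"
  shows "(\<lambda>N. of_nat (D2 q N)) \<sim>[at_top]
    (\<lambda>N. of_real w * L_function 1 chi / riemann_zeta 2 * of_nat N)"
proof -
  have "chi = (\<lambda>n. of_real (c n))" using chi by auto
  then have "of_real w * L_function 1 chi / riemann_zeta 2 = complex_of_real (L1 * (6 / pi\<^sup>2) * w)"
    by (simp add: L_function_eq riemann_zeta_2)
  moreover have "(\<lambda>N. of_nat (D2 q N) / of_nat N) \<longlonglongrightarrow> complex_of_real (L1 * (6 / pi\<^sup>2) * w)"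
    using tendsto_of_real[OF D2_over_N_tendsto[OF q mean], where 'a = complex] by simp
  moreover have "complex_of_real (L1 * (6 / pi\<^sup>2) * w) \<noteq> 0" using L1_nonzero \<open>w \<noteq> 0\<close> by simp
  ultimately show ?thesis unfolding \<open>of_real w * _ / _ = _\<close> by (intro asymp_equivI'_const)
qed

theorem theorem2:
  fixes q :: int
  assumes "prime \<bar>q\<bar> \<or> q = -1"
  shows "([q = 3] (mod 4) \<longrightarrow>
            (\<lambda>N. of_nat (D2 q N)) \<sim>[at_top]
            (\<lambda>N. L_function 1 (kronecker_char (4 * q)) / riemann_zeta 2 * of_nat N)) \<and>
         ([q = 5] (mod 8) \<longrightarrow>
            (\<lambda>N. of_nat (D2 q N)) \<sim>[at_top]
            (\<lambda>N. 2 * L_function 1 (kronecker_char q) / riemann_zeta 2 * of_nat N)) \<and>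
         ([q = 1] (mod 8) \<longrightarrow>
            (\<lambda>N. of_nat (D2 q N)) \<sim>[at_top]
            (\<lambda>N. L_function 1 (kronecker_char q) / riemann_zeta 2 * of_nat N))"
proof (intro conjI impI)
  assume "[q = 3] (mod 4)"
  then have q4: "q mod 4 = 3" by (simp add: cong_def)
  interpret real_character "\<lambda>n. real_of_int (kronecker (4 * q) (int n))" "4 * nat \<bar>q\<bar>"
    using real_character_kronecker_3[OF assms q4] .
  have "kronecker (4 * q) 2 = 0"
    using kronecker_prime_right[OF two_is_prime_nat] by (simp add: kronecker_prime_def)
  then have two: "reduced_divisor_sum (2 ^ k) = (if k \<le> 1 then 1 else 0)" for k
    unfolding reduced_divisor_sum_prime_power[OF two_is_prime_nat] by (auto simp: power_0_left)
  have odd: "odd q" using q4 by presburger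
  \<comment> \<open>The character vanishes at 2, so the Euler factor is 1 + x, with x = 2^-s. The
    root counts modulo 1, 2, 4, ... are 1, 1, 0, 0, ..., so no correction arises: u = v = 0.\<close>
  have "mean_value (\<lambda>n. real (card (sqrt_residues q n))) (L1 * (6 / pi\<^sup>2) * (1 + 0 / 2 + 0 / 4))"
  proof (rule mean_value_card_sqrt_residues[OF assms])
    fix l :: nat assume "prime l" "l > 2"
    then show "real_of_int (kronecker (4 * q) (int l)) = real_of_int (Legendre q (int l))"
      by (simp add: kronecker_prime_right kronecker_prime_def Legendre_4_mult)
  next
    fix k :: nat assume "k > 0"
    then show "real (card (sqrt_residues q (2 ^ k))) = reduced_divisor_sum (2 ^ k)
      + 0 * reduced_divisor_sum (2 ^ (k - 1)) + (if k \<ge> 2 then 0 * reduced_divisor_sum (2 ^ (k - 2)) else 0)"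
      using sqrt_residues_2[OF odd] sqrt_residues_empty_mod_4[OF q4, of k]
      unfolding two by (cases "k = 1") auto
  qed
  then show "(\<lambda>N. of_nat (D2 q N)) \<sim>[at_top]
      (\<lambda>N. L_function 1 (kronecker_char (4 * q)) / riemann_zeta 2 * of_nat N)"
    using D2_asymp_equiv[OF assms, of 1 "kronecker_char (4 * q)"] by (simp add: kronecker_char_def)
next
  assume "[q = 5] (mod 8)"
  then have q8: "q mod 8 = 5" by (simp add: cong_def)
  then have q4: "q mod 4 = 1" by presburger
  have "q \<noteq> -1" using q8 by auto
  then have pq: "prime \<bar>q\<bar>" using assms by simp
  interpret real_character "\<lambda>n. real_of_int (kronecker q (int n))" "nat \<bar>q\<bar>"
    using real_character_kronecker_1[OF pq q4] .
  have odd: "odd q" using q4 by presburger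
  have "kronecker q 2 = -1"
    using kronecker_prime_right[OF two_is_prime_nat, of q] odd q8 by (simp add: kronecker_prime_def)
  then have two: "reduced_divisor_sum (2 ^ k) = (if k = 0 then 1 else 0)" for k
    unfolding reduced_divisor_sum_prime_power[OF two_is_prime_nat] by (cases k) auto
  \<comment> \<open>The character value -1 at 2 gives the Euler factor 1, while the root counts are
    1, 1, 2, 0, 0, ... . The correction is 1 + x + 2 x^2, whose value 2 at x = 1/2 is the extra
    factor in the formula for this case.\<close>
  have "mean_value (\<lambda>n. real (card (sqrt_residues q n))) (L1 * (6 / pi\<^sup>2) * (1 + 1 / 2 + 2 / 4))"
  proof (rule mean_value_card_sqrt_residues[OF assms])
    fix l :: nat assume "prime l" "l > 2"
    then show "real_of_int (kronecker q (int l)) = real_of_int (Legendre q (int l))"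
      by (simp add: kronecker_prime_right kronecker_prime_def)
  next
    fix k :: nat assume "k > 0"
    then consider "k = 1" | "k = 2" | "k \<ge> 3" by linarith
    then show "real (card (sqrt_residues q (2 ^ k))) = reduced_divisor_sum (2 ^ k)
      + 1 * reduced_divisor_sum (2 ^ (k - 1)) + (if k \<ge> 2 then 2 * reduced_divisor_sum (2 ^ (k - 2)) else 0)"
      unfolding two using sqrt_residues_2[OF odd] sqrt_residues_4[OF q4] sqrt_residues_empty_mod_8[OF q8, of k]
      by cases auto
  qed
  then show "(\<lambda>N. of_nat (D2 q N)) \<sim>[at_top]
      (\<lambda>N. 2 * L_function 1 (kronecker_char q) / riemann_zeta 2 * of_nat N)"
    using D2_asymp_equiv[OF assms, of 2 "kronecker_char q"] by (simp add: kronecker_char_def)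
next
  assume "[q = 1] (mod 8)"
  then have q8: "q mod 8 = 1" by (simp add: cong_def)
  then have q4: "q mod 4 = 1" by presburger
  have "q \<noteq> -1" using q8 by auto
  then have pq: "prime \<bar>q\<bar>" using assms by simp
  interpret real_character "\<lambda>n. real_of_int (kronecker q (int n))" "nat \<bar>q\<bar>"
    using real_character_kronecker_1[OF pq q4] .
  have odd: "odd q" using q4 by presburger
  have "kronecker q 2 = 1"
    using kronecker_prime_right[OF two_is_prime_nat, of q] odd q8 by (simp add: kronecker_prime_def)
  then have two: "reduced_divisor_sum (2 ^ k) = (if k = 0 then 1 else 2)" for k
    unfolding reduced_divisor_sum_prime_power[OF two_is_prime_nat] by simp
  \<comment> \<open>The character value 1 at 2 gives (1 + x) / (1 - x) = 1 + 2 x + 2 x^2 + ...,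
    while the root counts are 1, 1, 2, 4, 4, ... . The quotient is 1 - x + 2 x^2, with value 1 at x
    = 1/2.\<close>
  have "mean_value (\<lambda>n. real (card (sqrt_residues q n))) (L1 * (6 / pi\<^sup>2) * (1 + (-1) / 2 + 2 / 4))"
  proof (rule mean_value_card_sqrt_residues[OF assms])
    fix l :: nat assume "prime l" "l > 2"
    then show "real_of_int (kronecker q (int l)) = real_of_int (Legendre q (int l))"
      by (simp add: kronecker_prime_right kronecker_prime_def)
  next
    fix k :: nat assume "k > 0"
    then consider "k = 1" | "k = 2" | "k \<ge> 3" by linarith
    then show "real (card (sqrt_residues q (2 ^ k))) = reduced_divisor_sum (2 ^ k)
      + (-1) * reduced_divisor_sum (2 ^ (k - 1)) + (if k \<ge> 2 then 2 * reduced_divisor_sum (2 ^ (k - 2)) else 0)"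
      unfolding two using sqrt_residues_2[OF odd] sqrt_residues_4[OF q4] sqrt_residues_2_power[OF q8, of k]
      by cases auto
  qed
  then show "(\<lambda>N. of_nat (D2 q N)) \<sim>[at_top]
      (\<lambda>N. L_function 1 (kronecker_char q) / riemann_zeta 2 * of_nat N)"
    using D2_asymp_equiv[OF assms, of 1 "kronecker_char q"] by (simp add: kronecker_char_def)
qed

end
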